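(* 1) If $G$ is sequentially $0$-continuous, then $G$ has the strong Trotter property. 2) If $G$ is Mackey $0$-continuous, then for each $\mu\in C^1([0,1],G)$ with $\mu(0)=e$, $\dot\mu(0)\in\mathrm{dom}[\exp]$ and $\delta^r(\mu)\in C^{\mathrm{lip}}([0,1],\mathfrak g)$, and for each $\ell>0$, one has $$\lim_{n\to\infty}\mu(\tau/n)^n=\exp(\tau\cdot\dot\mu(0))\quad\text{uniformly in }\tau\in[0,\ell].$$
   Context: $G$ is a Lie group in Milnor's infinite-dimensional sense: a smooth Hausdorff manifold modelled on a real Hausdorff locally convex vector space $E$ (no completeness assumed) with smooth group operations, where $C^k$ is understood in Bastiani's sense (iterated directional derivatives of order $p\le k$ exist and define continuous maps $(x,v_1,\dots,v_p)\mapsto d^p_xf(v_1,\dots,v_p)$). $e$ is the unit, $\mathfrak g=T_eG$, $R_g(h)=hg$. A curve on a compact interval is $C^1$ if it is the restriction of a $C^1$-curve on an open interval. $C^{\mathrm{lip}}([0,1],\mathfrak g)$ is the set of curves that are Lipschitz with respect to each continuous seminorm on $\mathfrak g$. For a continuous seminorm $q$ on $\mathfrak g$ put $q_\infty(\gamma)=\sup_tq(\gamma(t))$. For $\mu\in C^1([0,1],G)$ let $\delta^r(\mu)(t)=d_{\mu(t)}R_{\mu(t)^{-1}}(\dot\mu(t))$, and $\mathrm D=\{\delta^r(\mu):\mu\in C^1([0,1],G)\}\subseteq C^0([0,1],\mathfrak g)$. On $\mathrm D$, $\mathrm{Evol}(\delta^r(\mu)):=\mu\cdot\mu(0)^{-1}$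 is well defined. The exponential map is $\exp\colon\mathrm{dom}[\exp]\to G$, where $\mathrm{dom}[\exp]$ is the set of $X\in\mathfrak g$ whose constant curve $\phi_X\colon[0,1]\ni t\mapsto X$ lies in $\mathrm D$, and $\exp(X):=\mathrm{Evol}(\phi_X)(1)$; one has $\mathbb R\cdot\mathrm{dom}[\exp]\subseteq\mathrm{dom}[\exp]$. $\mathrm{Evol}(\phi_n)\to\mathrm{Evol}(\phi)$ uniformly means: for each neighbourhood $U$ of $e$ there is $n_U$ with $\mathrm{Evol}(\phi)(t)^{-1}\mathrm{Evol}(\phi_n)(t)\in U$ for all $t\in[0,1]$, $n\ge n_U$. $G$ is sequentially $0$-continuous if for all $\phi_n,\phi\in\mathrm D$ with $q_\infty(\phi-\phi_n)\to0$ for each continuous seminorm $q$ on $\mathfrak g$, one has $\mathrm{Evol}(\phi_n)\to\mathrm{Evol}(\phi)$ uniformly. $G$ is Mackey $0$-continuous if the same conclusion holds for all $\phi_n,\phi\in\mathrm D$ for which there are constants $c_q\ge0$, $l_q\in\mathbb N$ (one pair for each continuous seminorm $q$ on $\mathfrak g$) and a sequence $\lambda_n\ge0$, $\lambda_n\to0$, with $q_\infty(\phi-\phi_n)\le c_q\lambda_n$ for all $n\ge l_q$ and all $q$. $G$ has the strong Trotter property if for each $\mu\in C^1([0,1],G)$ with $\mu(0)=e$ and $\dot\mu(0)\in\mathrm{dom}[\exp]$, and each $\ell>0$, $\lim_n\mu(\tau/n)^n=\exp(\tau\cdot\dot\mu(0))$ uniformly in $\tau\in[0,\ell]$. Here the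 uniform limit means: for each neighbourhood $U\subseteq G$ of $e$ there is $n_U\in\mathbb N$ (with $n_U\ge\max(\ell,1)$) such that $\exp(-\tau\cdot\dot\mu(0))\cdot\mu(\tau/n)^n\in U$ for all $n\ge n_U$, $\tau\in[0,\ell]$. *)

theory Defs
  imports "HOL-Analysis.Analysis" "HOL-Algebra.Group"
begin

section \<open>Hausdorff locally convex spaces\<close>

class locally_convex_space = real_vector + topological_ab_group_add + t2_space +
  assumes tendsto_scaleR_nhds:
    "((\<lambda>p. fst p *\<^sub>R snd p) \<longlongrightarrow> a *\<^sub>R x) (nhds a \<times>\<^sub>F nhds x)"
  and convex_nhds_zero:
    "open U \<Longrightarrow> 0 \<in> U \<Longrightarrow> \<exists>V. open V \<and> 0 \<in> V \<and> V \<subseteq> U \<and>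
       (\<forall>x\<in>V. \<forall>y\<in>V. \<forall>u\<ge>0. \<forall>v\<ge>0. u + v = 1 \<longrightarrow> u *\<^sub>R x + v *\<^sub>R y \<in> V)"
  \<comment> \<open>the last conjunct is \<open>convex V\<close>, a constant not usable inside a class specification\<close>


section \<open>Bastiani differentiability\<close>

definition dir_quotient ::
    "('a::real_vector \<Rightarrow> 'b::real_vector) \<Rightarrow> 'a \<Rightarrow> 'a \<Rightarrow> real \<Rightarrow> 'b" where
  "dir_quotient f x v h = (1 / h) *\<^sub>R (f (x + h *\<^sub>R v) - f x)"

definition dir_deriv ::
    "('a::real_vector \<Rightarrow> 'b::{real_vector,t2_space}) \<Rightarrow> 'a \<Rightarrow> 'a \<Rightarrow> 'b" where
  "dir_deriv f x v = Lim (at 0) (dir_quotient f x v)"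

fun iter_deriv ::
    "('a::real_vector \<Rightarrow> 'b::{real_vector,t2_space}) \<Rightarrow> 'a list \<Rightarrow> 'a \<Rightarrow> 'b" where
  "iter_deriv f [] = f"
| "iter_deriv f (v # vs) = (\<lambda>x. dir_deriv (iter_deriv f vs) x v)"

text \<open>
  In the continuity clause a vector of \<open>p\<close> directions is encoded as the first \<open>p\<close> entries of a
  sequence, and sequences carry the product topology. As the map depends on these entries only,
  this is continuity on \<open>U \<times> 'a\<^sup>p\<close>.
\<close>

definition bastiani_C ::
    "nat \<Rightarrow> ('a::{real_vector,topological_space} \<Rightarrow> 'b::{real_vector,t2_space}) \<Rightarrow> 'a set \<Rightarrow> bool"
  where
  "bastiani_C k f U \<longleftrightarrow> open U \<and>
     (\<forall>vs v. length vs < k \<longrightarrow>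
        (\<forall>x\<in>U. \<exists>l. (dir_quotient (iter_deriv f vs) x v \<longlongrightarrow> l) (at 0))) \<and>
     (\<forall>p\<le>k. continuous_on (U \<times> (UNIV :: (nat \<Rightarrow> 'a) set))
        (\<lambda>(x, w). iter_deriv f (map w [0..<p]) x))"

definition bastiani_smooth ::
    "('a::{real_vector,topological_space} \<Rightarrow> 'b::{real_vector,t2_space}) \<Rightarrow> 'a set \<Rightarrow> bool" where
  "bastiani_smooth f U \<longleftrightarrow> (\<forall>k. bastiani_C k f U)"


section \<open>Manifolds and tangent vectors\<close>

text \<open>
  A chart is a pair of its domain and its coordinate map; the values of the map outside the
  domain are irrelevant.
\<close>

type_synonym ('g, 'e) chart = "'g set \<times> ('g \<Rightarrow> 'e)"

abbreviation chart_inv :: "('g, 'e) chart \<Rightarrow> 'e \<Rightarrow> 'g" where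
  "chart_inv c \<equiv> inv_into (fst c) (snd c)"

definition smooth_atlas ::
    "('g::t2_space, 'e::locally_convex_space) chart set \<Rightarrow> bool" where
  "smooth_atlas A \<longleftrightarrow>
     (\<Union>(fst ` A)) = UNIV \<and>
     (\<forall>c\<in>A. open (fst c) \<and> open (snd c ` fst c) \<and>
        homeomorphism (fst c) (snd c ` fst c) (snd c) (chart_inv c)) \<and>
     (\<forall>c\<in>A. \<forall>d\<in>A. bastiani_smooth (snd d \<circ> chart_inv c) (snd c ` (fst c \<inter> fst d)))"

definition charts_at :: "('g, 'e) chart set \<Rightarrow> 'g \<Rightarrow> ('g, 'e) chart set" where
  "charts_at A p = {c \<in> A. p \<in> fst c}"

text \<open>
  A tangent vector at \<open>p\<close> is the family of its coordinate representations in the charts around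
  \<open>p\<close>, which transform under the derivatives of the chart changes. Entries for all other indices
  are \<open>0\<close>, so linear operations are pointwise. The topology of a tangent space is the subspace
  topology of the product topology on families; each entry at a chart around \<open>p\<close> determines the
  others by a continuous linear map, hence each such evaluation is a homeomorphism onto the
  modelling space.
\<close>

type_synonym ('g, 'e) tvec = "('g, 'e) chart \<Rightarrow> 'e"

definition tangent_space ::
    "('g, 'e::locally_convex_space) chart set \<Rightarrow> 'g \<Rightarrow> ('g, 'e) tvec set" where
  "tangent_space A p = {X.
     (\<forall>c. c \<notin> charts_at A p \<longrightarrow> X c = 0) \<and>
     (\<forall>c\<in>charts_at A p. \<forall>d\<in>charts_at A p.
        X d = dir_deriv (snd d \<circ> chart_inv c) (snd c p) (X c))}"

definition tvec_add ::
    "('g, 'e::real_vector) tvec \<Rightarrow> ('g, 'e) tvec \<Rightarrow> ('g, 'e) tvec" where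
  "tvec_add X Y = (\<lambda>c. X c + Y c)"

definition tvec_diff ::
    "('g, 'e::real_vector) tvec \<Rightarrow> ('g, 'e) tvec \<Rightarrow> ('g, 'e) tvec" where
  "tvec_diff X Y = (\<lambda>c. X c - Y c)"

definition tvec_scale :: "real \<Rightarrow> ('g, 'e::real_vector) tvec \<Rightarrow> ('g, 'e) tvec" where
  "tvec_scale r X = (\<lambda>c. r *\<^sub>R X c)"

text \<open>
  The differential at \<open>p\<close> of a smooth self-map of the manifold; by the chain rule it does not
  depend on the chart selected around \<open>p\<close>.
\<close>

definition tangent_map ::
    "('g, 'e::locally_convex_space) chart set \<Rightarrow> ('g \<Rightarrow> 'g) \<Rightarrow> 'g \<Rightarrow> ('g, 'e) tvec \<Rightarrow> ('g, 'e) tvec"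
  where
  "tangent_map A f p X =
     (let c = (SOME c. c \<in> charts_at A p) in
      (\<lambda>d. if d \<in> charts_at A (f p)
           then dir_deriv (snd d \<circ> f \<circ> chart_inv c) (snd c p) (X c)
           else 0))"

definition C1_curve_on ::
    "('g::t2_space, 'e::locally_convex_space) chart set \<Rightarrow> real set \<Rightarrow> (real \<Rightarrow> 'g) \<Rightarrow> bool" where
  "C1_curve_on A J \<mu> \<longleftrightarrow>
     continuous_on J \<mu> \<and> (\<forall>c\<in>A. bastiani_C 1 (snd c \<circ> \<mu>) {t \<in> J. \<mu> t \<in> fst c})"

text \<open>
  Curves on \<open>[0,1]\<close> are functions on the real line of which only the values on \<open>[0,1]\<close> matter.
\<close>

definition C1_unit_curve ::
    "('g::t2_space, 'e::locally_convex_space) chart set \<Rightarrow> (real \<Rightarrow> 'g) \<Rightarrow> bool" where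
  "C1_unit_curve A \<mu> \<longleftrightarrow>
     (\<exists>a b \<nu>. a < 0 \<and> 1 < b \<and> C1_curve_on A {a<..<b} \<nu> \<and> (\<forall>t\<in>{0..1}. \<nu> t = \<mu> t))"

definition velocity ::
    "('g, 'e::locally_convex_space) chart set \<Rightarrow> (real \<Rightarrow> 'g) \<Rightarrow> real \<Rightarrow> ('g, 'e) tvec" where
  "velocity A \<mu> t =
     (\<lambda>c. if c \<in> charts_at A (\<mu> t)
          then Lim (at t within {0..1}) (\<lambda>s. (1 / (s - t)) *\<^sub>R (snd c (\<mu> s) - snd c (\<mu> t)))
          else 0)"


section \<open>Lie groups\<close>

locale lie_group = group G
  for G :: "'g::t2_space monoid" (structure) +
  fixes A :: "('g, 'e::locally_convex_space) chart set"
  assumes carrier_UNIV: "carrier G = UNIV"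
    and atlas: "smooth_atlas A"
    and continuous_mult: "continuous_on UNIV (\<lambda>(x, y). x \<otimes> y)"
    and smooth_mult: "\<lbrakk>c \<in> A; d \<in> A; r \<in> A\<rbrakk> \<Longrightarrow>
      bastiani_smooth (\<lambda>(x, y). snd r (chart_inv c x \<otimes> chart_inv d y))
        {(x, y). x \<in> snd c ` fst c \<and> y \<in> snd d ` fst d \<and> chart_inv c x \<otimes> chart_inv d y \<in> fst r}"
    and continuous_inverse: "continuous_on UNIV (\<lambda>x. inv x)"
    and smooth_inverse: "\<lbrakk>c \<in> A; d \<in> A\<rbrakk> \<Longrightarrow>
      bastiani_smooth (\<lambda>x. snd d (inv (chart_inv c x)))
        {x \<in> snd c ` fst c. inv (chart_inv c x) \<in> fst d}"
begin

definition lie_algebra :: "('g, 'e) tvec set" where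
  "lie_algebra = tangent_space A \<one>"

definition cont_seminorm :: "(('g, 'e) tvec \<Rightarrow> real) \<Rightarrow> bool" where
  "cont_seminorm q \<longleftrightarrow>
     continuous_on lie_algebra q \<and>
     (\<forall>X\<in>lie_algebra. \<forall>Y\<in>lie_algebra. q (tvec_add X Y) \<le> q X + q Y) \<and>
     (\<forall>r. \<forall>X\<in>lie_algebra. q (tvec_scale r X) = \<bar>r\<bar> * q X)"

definition sup_seminorm ::
    "(('g, 'e) tvec \<Rightarrow> real) \<Rightarrow> (real \<Rightarrow> ('g, 'e) tvec) \<Rightarrow> real" where
  "sup_seminorm q \<gamma> = (SUP t\<in>{0..1}. q (\<gamma> t))"

definition curve_diff ::
    "(real \<Rightarrow> ('g, 'e) tvec) \<Rightarrow> (real \<Rightarrow> ('g, 'e) tvec) \<Rightarrow> real \<Rightarrow> ('g, 'e) tvec" where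
  "curve_diff \<phi> \<psi> = (\<lambda>t. tvec_diff (\<phi> t) (\<psi> t))"

definition lipschitz_curve :: "(real \<Rightarrow> ('g, 'e) tvec) \<Rightarrow> bool" where
  "lipschitz_curve \<gamma> \<longleftrightarrow>
     (\<forall>t\<in>{0..1}. \<gamma> t \<in> lie_algebra) \<and>
     (\<forall>q. cont_seminorm q \<longrightarrow>
        (\<exists>L. \<forall>s\<in>{0..1}. \<forall>t\<in>{0..1}. q (tvec_diff (\<gamma> s) (\<gamma> t)) \<le> L * \<bar>s - t\<bar>))"

definition right_log_deriv :: "(real \<Rightarrow> 'g) \<Rightarrow> real \<Rightarrow> ('g, 'e) tvec" where
  "right_log_deriv \<mu> t = tangent_map A (\<lambda>h. h \<otimes> inv (\<mu> t)) (\<mu> t) (velocity A \<mu> t)"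

definition is_log_deriv :: "(real \<Rightarrow> 'g) \<Rightarrow> (real \<Rightarrow> ('g, 'e) tvec) \<Rightarrow> bool" where
  "is_log_deriv \<mu> \<phi> \<longleftrightarrow>
     C1_unit_curve A \<mu> \<and> (\<forall>t\<in>{0..1}. \<phi> t = right_log_deriv \<mu> t)"

definition evol_domain :: "(real \<Rightarrow> ('g, 'e) tvec) set" where
  "evol_domain = {\<phi>. \<exists>\<mu>. is_log_deriv \<mu> \<phi>}"

definition Evol :: "(real \<Rightarrow> ('g, 'e) tvec) \<Rightarrow> real \<Rightarrow> 'g" where
  "Evol \<phi> t = (THE g. \<exists>\<mu>. is_log_deriv \<mu> \<phi> \<and> g = \<mu> t \<otimes> inv (\<mu> 0))"

definition dom_exp :: "('g, 'e) tvec set" where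
  "dom_exp = {X \<in> lie_algebra. (\<lambda>t. X) \<in> evol_domain}"

definition lie_exp :: "('g, 'e) tvec \<Rightarrow> 'g" where
  "lie_exp X = Evol (\<lambda>t. X) 1"

definition Evol_converges ::
    "(nat \<Rightarrow> real \<Rightarrow> ('g, 'e) tvec) \<Rightarrow> (real \<Rightarrow> ('g, 'e) tvec) \<Rightarrow> bool" where
  "Evol_converges \<Phi> \<phi> \<longleftrightarrow>
     (\<forall>U. open U \<and> \<one> \<in> U \<longrightarrow>
        (\<exists>N. \<forall>n\<ge>N. \<forall>t\<in>{0..1}. inv (Evol \<phi> t) \<otimes> Evol (\<Phi> n) t \<in> U))"

definition sequentially_0_continuous :: bool where
  "sequentially_0_continuous \<longleftrightarrow>
     (\<forall>\<Phi> \<phi>. (\<forall>n. \<Phi> n \<in> evol_domain) \<and> \<phi> \<in> evol_domain \<and>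
        (\<forall>q. cont_seminorm q \<longrightarrow> (\<lambda>n. sup_seminorm q (curve_diff \<phi> (\<Phi> n))) \<longlonglongrightarrow> 0)
        \<longrightarrow> Evol_converges \<Phi> \<phi>)"

definition Mackey_converges ::
    "(nat \<Rightarrow> real \<Rightarrow> ('g, 'e) tvec) \<Rightarrow> (real \<Rightarrow> ('g, 'e) tvec) \<Rightarrow> bool" where
  "Mackey_converges \<Phi> \<phi> \<longleftrightarrow>
     (\<exists>(C :: (('g, 'e) tvec \<Rightarrow> real) \<Rightarrow> real) (l :: (('g, 'e) tvec \<Rightarrow> real) \<Rightarrow> nat) (r :: nat \<Rightarrow> real).
        (\<forall>n. 0 \<le> r n) \<and> r \<longlonglongrightarrow> 0 \<and>
        (\<forall>q. cont_seminorm q \<longrightarrow> 0 \<le> C q \<and>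
           (\<forall>n\<ge>l q. sup_seminorm q (curve_diff \<phi> (\<Phi> n)) \<le> C q * r n)))"

definition Mackey_0_continuous :: bool where
  "Mackey_0_continuous \<longleftrightarrow>
     (\<forall>\<Phi> \<phi>. (\<forall>n. \<Phi> n \<in> evol_domain) \<and> \<phi> \<in> evol_domain \<and> Mackey_converges \<Phi> \<phi>
        \<longrightarrow> Evol_converges \<Phi> \<phi>)"

text \<open>
  The bound \<open>max l 1 \<le> N\<close> guarantees that \<open>\<tau> / n\<close> lies in \<open>[0,1]\<close>, where \<open>\<mu>\<close> is specified.
\<close>

definition Trotter_limit :: "(real \<Rightarrow> 'g) \<Rightarrow> real \<Rightarrow> bool" where
  "Trotter_limit \<mu> l \<longleftrightarrow>
     (\<forall>U. open U \<and> \<one> \<in> U \<longrightarrow>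
        (\<exists>N::nat. max l 1 \<le> real N \<and>
           (\<forall>n\<ge>N. \<forall>\<tau>\<in>{0..l}.
              lie_exp (tvec_scale (- \<tau>) (velocity A \<mu> 0)) \<otimes> \<mu> (\<tau> / real n) [^] n \<in> U)))"

definition strong_Trotter_property :: bool where
  "strong_Trotter_property \<longleftrightarrow>
     (\<forall>\<mu>. C1_unit_curve A \<mu> \<and> \<mu> 0 = \<one> \<and> velocity A \<mu> 0 \<in> dom_exp \<longrightarrow>
        (\<forall>l>0. Trotter_limit \<mu> l))"

end

end

theory Submission
  imports Defs
begin

text \<open>
  Let \<open>X\<close> be the velocity of \<open>\<mu>\<close> at \<open>0\<close>, let \<open>e\<close> be the one-parameter group of \<open>X\<close>, and let \<open>\<theta>\<close> be a
  monotone reparametrization of the line that commutes with integer translations and is stationary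
  at the integers. Concatenating \<open>n\<close> right translates of \<open>u \<mapsto> \<mu>(\<tau> \<theta>(u) / n)\<close>, \<open>u \<in> [0,1]\<close>, gives a
  \<open>C\<^sup>1\<close> curve \<open>M\<close> from the unit to \<open>\<mu>(\<tau>/n)\<^sup>n\<close>. The curve \<open>t \<mapsto> e(\<tau> \<theta>(nt) / n)\<inverse> M(nt)\<close> runs from the unit
  to \<open>exp(-\<tau>X) \<mu>(\<tau>/n)\<^sup>n\<close>, and its right logarithmic derivative at \<open>t\<close> is
  \<open>\<tau> \<theta>'(nt) Ad(e(y)\<inverse>)(\<delta>\<^sup>r(\<mu>)(s) - X)\<close> for some \<open>y \<in> [0,\<tau>]\<close> and \<open>s \<in> [0,\<tau>/n]\<close>. As \<open>\<delta>\<^sup>r(\<mu>)(0) = X\<close>, these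
  curves in the Lie algebra tend to \<open>0\<close> uniformly, and at rate \<open>1/n\<close> if \<open>\<delta>\<^sup>r(\<mu>)\<close> is Lipschitz.
  Hence the continuity of the evolution map is needed only at the zero curve.
\<close>

section \<open>Calculus in locally convex spaces\<close>

text \<open>Continuity of evolution applies only to curves in \<open>evol_domain\<close>, that is,
  to logarithmic derivatives of C1 curves. A concatenation of copies of \<mu> may have corners at
  its junctions; \<theta> brings the speed to zero there, and running \<open>e\<close> along the
  same \<theta> produces the common factor in front of the difference. The copies are translated on
  the right because right logarithmic derivatives do not see right translations. Dividing by
  \<open>e\<close> costs an adjoint action, whose uniform control is the analytic core:
  \<open>Ad\<close> is jointly continuous and its argument runs over a compact arc, so the tube
  lemma dominates each continuous seminorm of all these images by a single continuous seminorm.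
  Neither completeness nor barrelledness enters. Uniformity in \<tau> comes for free: the hypothesis
  is about arbitrary sequences of curves, so a violating \<tau> may be picked afresh for each n. In
  the calculus, convex open sets replace norms: difference quotients lie in any such set containing
  all derivatives. This yields the chain rule and shows that a curve with zero logarithmic
  derivative is constant, hence uniqueness of evolutions.\<close>

instance prod :: (topological_monoid_add, topological_monoid_add) topological_monoid_add
proof
  fix a b :: "'a \<times> 'b"
  have "((\<lambda>x. fst (fst x) + fst (snd x)) \<longlongrightarrow> fst a + fst b) (nhds a \<times>\<^sub>F nhds b)"
    "((\<lambda>x. snd (fst x) + snd (snd x)) \<longlongrightarrow> snd a + snd b) (nhds a \<times>\<^sub>F nhds b)"
    by (intro tendsto_intros filterlim_fst filterlim_snd)+
  from tendsto_Pair[OF this]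
  show "((\<lambda>x. fst x + snd x) \<longlongrightarrow> a + b) (nhds a \<times>\<^sub>F nhds b)"
    by (simp add: plus_prod_def)
qed

instance prod :: (topological_group_add, topological_group_add) topological_group_add
proof
  fix a :: "'a \<times> 'b"
  have "((\<lambda>x. - fst x) \<longlongrightarrow> - fst a) (nhds a)" "((\<lambda>x. - snd x) \<longlongrightarrow> - snd a) (nhds a)"
    by (intro tendsto_intros filterlim_ident)+
  from tendsto_Pair[OF this] show "(uminus \<longlongrightarrow> - a) (nhds a)"
    by (simp add: uminus_prod_def [abs_def])
qed

instance prod :: (topological_ab_group_add, topological_ab_group_add) topological_ab_group_add ..

lemma tendsto_scaleR_lcs:
  fixes g :: "'a \<Rightarrow> 'e::locally_convex_space"
  assumes "(f \<longlongrightarrow> a) F" "(g \<longlongrightarrow> x) F"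
  shows "((\<lambda>t. f t *\<^sub>R g t) \<longlongrightarrow> a *\<^sub>R x) F"
  using filterlim_compose[OF tendsto_scaleR_nhds filterlim_Pair[OF assms]] by simp

lemma convex_open_nhd_zero:
  fixes U :: "'e::locally_convex_space set"
  assumes "open U" "0 \<in> U"
  obtains V where "open V" "0 \<in> V" "V \<subseteq> U" "convex V"
  using convex_nhds_zero[OF assms] unfolding convex_def by auto

lemma convex_open_nhd:
  fixes U :: "'e::locally_convex_space set"
  assumes "open U" "x \<in> U"
  obtains V where "open V" "x \<in> V" "V \<subseteq> U" "convex V"
proof -
  have "open ((\<lambda>y. x + y) -` U)"
    using assms(1) by (intro open_vimage continuous_intros) auto
  moreover have "0 \<in> (\<lambda>y. x + y) -` U" using assms(2) by simp
  ultimately obtain V where V: "open V" "0 \<in> V" "V \<subseteq> (\<lambda>y. x + y) -` U" "convex V"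
    by (rule convex_open_nhd_zero)
  show thesis
  proof
    show "open ((\<lambda>y. y - x) -` V)"
      using V(1) by (intro open_vimage continuous_intros) auto
    have "(\<lambda>y. y - x) -` V = (\<lambda>y. x + y) ` V"
      by (auto simp: image_iff algebra_simps intro!: bexI[of _ "_ - x"])
    then show "convex ((\<lambda>y. y - x) -` V)"
      using convex_translation[OF V(4), of x] by simp
    show "x \<in> (\<lambda>y. y - x) -` V" using V(2) by simp
    show "(\<lambda>y. y - x) -` V \<subseteq> U"
    proof
      fix y assume "y \<in> (\<lambda>y. y - x) -` V"
      then have "x + (y - x) \<in> U" using V(3) by blast
      then show "y \<in> U" by simp
    qed
  qed
qed

text \<open>Multiplication read in charts is a map on \<open>'e \<times> 'e\<close>; this instance
  lets the calculus treat it like any other C1 map.\<close>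

instance prod :: (locally_convex_space, locally_convex_space) locally_convex_space
proof
  fix a :: real and x :: "'a \<times> 'b"
  have "((\<lambda>p. fst p *\<^sub>R fst (snd p)) \<longlongrightarrow> a *\<^sub>R fst x) (nhds a \<times>\<^sub>F nhds x)"
    "((\<lambda>p. fst p *\<^sub>R snd (snd p)) \<longlongrightarrow> a *\<^sub>R snd x) (nhds a \<times>\<^sub>F nhds x)"
    by (intro tendsto_scaleR_lcs tendsto_fst tendsto_snd filterlim_fst filterlim_snd)+
  from tendsto_Pair[OF this]
  show "((\<lambda>p. fst p *\<^sub>R snd p) \<longlongrightarrow> a *\<^sub>R x) (nhds a \<times>\<^sub>F nhds x)"
    by (simp add: scaleR_prod_def)
next
  fix U :: "('a \<times> 'b) set" assume "open U" "0 \<in> U"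
  then obtain A B where AB: "open A" "open B" "0 \<in> A \<times> B" "A \<times> B \<subseteq> U"
    by (rule open_prod_elim)
  obtain V where V: "open V" "0 \<in> V" "V \<subseteq> A" "convex V"
    by (rule convex_open_nhd_zero[OF AB(1)]) (use AB(3) in \<open>auto simp: zero_prod_def\<close>)
  obtain W where W: "open W" "0 \<in> W" "W \<subseteq> B" "convex W"
    by (rule convex_open_nhd_zero[OF AB(2)]) (use AB(3) in \<open>auto simp: zero_prod_def\<close>)
  show "\<exists>V. open V \<and> 0 \<in> V \<and> V \<subseteq> U \<and>
       (\<forall>x\<in>V. \<forall>y\<in>V. \<forall>u\<ge>0. \<forall>v\<ge>0. u + v = 1 \<longrightarrow> u *\<^sub>R x + v *\<^sub>R y \<in> V)"
    using V W AB(4)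
    by (intro exI[of _ "V \<times> W"] conjI open_Times)
      (auto simp: zero_prod_def scaleR_prod_def convex_def)
qed

subsection \<open>Derivatives of curves\<close>

text \<open>A relation taken within a set, so that one notion covers one-sided derivatives at the
  ends of an interval and two-sided ones. If \<open>t\<close> is isolated from \<open>S\<close>,
  every \<open>v\<close> qualifies; hence the \<open>bot\<close> hypotheses in uniqueness
  results.\<close>

definition curve_deriv :: "(real \<Rightarrow> 'e::locally_convex_space) \<Rightarrow> 'e \<Rightarrow> real \<Rightarrow> real set \<Rightarrow> bool" where
  "curve_deriv f v t S \<longleftrightarrow> ((\<lambda>s. (1 / (s - t)) *\<^sub>R (f s - f t)) \<longlongrightarrow> v) (at t within S)"

lemma curve_deriv_const: "curve_deriv (\<lambda>_. x) 0 t S"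
  by (simp add: curve_deriv_def)

lemma curve_deriv_mono: "curve_deriv f v t S \<Longrightarrow> T \<subseteq> S \<Longrightarrow> curve_deriv f v t T"
  unfolding curve_deriv_def by (rule tendsto_within_subset)

lemma curve_deriv_unique:
  "curve_deriv f v t S \<Longrightarrow> curve_deriv f w t S \<Longrightarrow> at t within S \<noteq> bot \<Longrightarrow> v = w"
  unfolding curve_deriv_def by (rule tendsto_unique)

lemma curve_deriv_cong:
  assumes "curve_deriv f v t S" "eventually (\<lambda>s. f s = g s) (at t within S)" "f t = g t"
  shows "curve_deriv g v t S"
  using assms(1) unfolding curve_deriv_def
  by (rule Lim_transform_eventually) (use assms(2,3) in \<open>auto elim: eventually_mono\<close>)

lemma curve_deriv_continuous:
  assumes "curve_deriv f v t S" shows "(f \<longlongrightarrow> f t) (at t within S)"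
proof -
  have "((\<lambda>s. f t + (s - t) *\<^sub>R ((1 / (s - t)) *\<^sub>R (f s - f t))) \<longlongrightarrow> f t + (t - t) *\<^sub>R v) (at t within S)"
    using assms unfolding curve_deriv_def
    by (intro tendsto_add tendsto_scaleR_lcs tendsto_diff tendsto_const tendsto_ident_at)
  then have "((\<lambda>s. f t + (s - t) *\<^sub>R ((1 / (s - t)) *\<^sub>R (f s - f t))) \<longlongrightarrow> f t) (at t within S)"
    by simp
  then show ?thesis
    by (rule Lim_transform_eventually) (auto simp: eventually_at intro!: exI[of _ 1])
qed

lemma curve_deriv_Pair:
  "curve_deriv f v t S \<Longrightarrow> curve_deriv g w t S \<Longrightarrow> curve_deriv (\<lambda>s. (f s, g s)) (v, w) t S"
  unfolding curve_deriv_def by (drule (1) tendsto_Pair) (simp add: scaleR_prod_def minus_prod_def)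

lemma curve_deriv_line: "curve_deriv (\<lambda>s. x + s *\<^sub>R v) v 0 S"
  unfolding curve_deriv_def
  by (rule Lim_transform_eventually[OF tendsto_const]) (auto simp: eventually_at intro!: exI[of _ 1])

lemma curve_deriv_reparam:
  assumes c: "curve_deriv c v (f t) T" and f: "(f has_real_derivative d) (at t within S)"
    and "f ` S \<subseteq> T"
  shows "curve_deriv (\<lambda>s. c (f s)) (d *\<^sub>R v) t S"
proof -
  \<comment> \<open>\<open>f s = f t\<close> may occur for \<open>s \<noteq> t\<close>. Giving the
    quotient its limit \<open>v\<close> at \<open>f t\<close> makes \<open>g\<close> continuous
    there, so it can be composed with \<open>f\<close>.\<close>
  define g where "g u = (if u = f t then v else (1 / (u - f t)) *\<^sub>R (c u - c (f t)))" for u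
  have "(g \<longlongrightarrow> v) (at (f t) within T)"
    using c unfolding curve_deriv_def
    by (rule Lim_transform_eventually) (auto simp: eventually_at g_def intro!: exI[of _ 1])
  then have "continuous (at (f t) within T) g"
    by (simp add: continuous_within g_def)
  then have "continuous (at (f t) within f ` S) g"
    using assms(3) continuous_within_subset by blast
  moreover have "continuous (at t within S) f"
    using f by (rule DERIV_continuous)
  ultimately have "continuous (at t within S) (g \<circ> f)"
    by (intro continuous_within_compose)
  then have "((\<lambda>s. g (f s)) \<longlongrightarrow> v) (at t within S)"
    by (simp add: continuous_within g_def comp_def)
  moreover have "((\<lambda>s. (f s - f t) / (s - t)) \<longlongrightarrow> d) (at t within S)"
    using f by (simp add: has_field_derivative_iff)
  ultimately have "((\<lambda>s. ((f s - f t) / (s - t)) *\<^sub>R g (f s)) \<longlongrightarrow> d *\<^sub>R v) (at t within S)"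
    by (intro tendsto_scaleR_lcs)
  moreover have "((f s - f t) / (s - t)) *\<^sub>R g (f s) = (1 / (s - t)) *\<^sub>R (c (f s) - c (f t))" for s
    by (auto simp: g_def)
  ultimately show ?thesis by (simp add: curve_deriv_def)
qed

lemma difference_quotient_sym:
  fixes a b :: "'e::real_vector"
  shows "(1 / (y - x)) *\<^sub>R (a - b) = (1 / (x - y)) *\<^sub>R (b - a)"
proof -
  have "1 / (y - x) = - (1 / (x - y))"
    using minus_divide_right[of 1 "x - y"] by simp
  then show ?thesis by (simp add: scaleR_right_diff_distrib)
qed

text \<open>Mean value theorem without a norm. The quotient over an interval is a convex combination
  of those over two adjacent subintervals, so membership in \<open>K\<close> survives gluing. Near
  each point it follows from the derivative there, as \<open>K\<close> is open; bisection makes it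
  global.\<close>

lemma difference_quotient_in_convex:
  fixes f :: "real \<Rightarrow> 'e::locally_convex_space"
  assumes "a < b" "open K" "convex K"
    and deriv: "\<And>t. t \<in> {a..b} \<Longrightarrow> \<exists>v\<in>K. curve_deriv f v t {a..b}"
  shows "(1 / (b - a)) *\<^sub>R (f b - f a) \<in> K"
proof -
  define Q where "Q x y = (1 / (y - x)) *\<^sub>R (f y - f x)" for x y
  define P where "P x y \<longleftrightarrow> (a \<le> x \<longrightarrow> x < y \<longrightarrow> y \<le> b \<longrightarrow> Q x y \<in> K)" for x y
  have Q_sym: "Q x y = Q y x" for x y
    unfolding Q_def by (rule difference_quotient_sym)
  have P_trans: "P x z" if "P x y" "P y z" "x \<le> y" "y \<le> z" for x y z
  proof (cases "x = y \<or> y = z")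
    case False
    then have *: "x < y" "y < z" using that by auto
    define u v where "u = (y - x) / (z - x)" and "v = (z - y) / (z - x)"
    have uv: "0 \<le> u" "0 \<le> v" "u + v = 1"
      using * by (auto simp: u_def v_def add_divide_distrib[symmetric])
    have "u *\<^sub>R Q x y = (1 / (z - x)) *\<^sub>R (f y - f x)"
      "v *\<^sub>R Q y z = (1 / (z - x)) *\<^sub>R (f z - f y)"
      using * by (simp_all add: Q_def u_def v_def)
    then have "u *\<^sub>R Q x y + v *\<^sub>R Q y z = (1 / (z - x)) *\<^sub>R ((f y - f x) + (f z - f y))"
      by (simp only: scaleR_add_right)
    then have "u *\<^sub>R Q x y + v *\<^sub>R Q y z = Q x z"
      by (simp add: Q_def)
    moreover have "u *\<^sub>R Q x y + v *\<^sub>R Q y z \<in> K" if "Q x y \<in> K" "Q y z \<in> K"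
      using \<open>convex K\<close> that uv by (rule convexD)
    ultimately show ?thesis
      using that * by (auto simp: P_def)
  qed (use that in auto)
  have "P a b"
    using less_imp_le[OF assms(1)]
  proof (induct rule: Bolzano)
    case (trans x y z)
    then show ?case by (rule P_trans)
  next
    case (local x)
    then obtain v where v: "v \<in> K" "curve_deriv f v x {a..b}"
      using deriv[of x] by (meson atLeastAtMost_iff)
    then have "eventually (\<lambda>s. Q x s \<in> K) (at x within {a..b})"
      unfolding curve_deriv_def Q_def using \<open>open K\<close> by (simp add: topological_tendstoD)
    then obtain d where d: "d > 0" "\<And>s. s \<in> {a..b} \<Longrightarrow> s \<noteq> x \<Longrightarrow> \<bar>s - x\<bar> < d \<Longrightarrow> Q x s \<in> K"
      by (auto simp: eventually_at dist_real_def)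
    \<comment> \<open>Only quotients with one end at \<open>x\<close> are controlled by the
      derivative at \<open>x\<close>, so the interval is split there.\<close>
    have "P r s" if "r \<le> x" "x \<le> s" "s - r < d" for r s
    proof (rule P_trans[OF _ _ that(1,2)])
      show "P r x" "P x s"
        unfolding P_def using d(2)[of r] d(2)[of s] that local Q_sym[of r x] by auto
    qed
    then show ?case using d(1) by blast
  qed
  then show ?thesis using assms(1) by (simp add: P_def Q_def)
qed

text \<open>In a Hausdorff locally convex space, a nonzero difference quotient is avoided by some
  convex open neighbourhood of 0. That neighbourhood contains every derivative, which contradicts
  the mean value theorem.\<close>

lemma zero_curve_deriv_constant:
  fixes f :: "real \<Rightarrow> 'e::locally_convex_space"
  assumes "a \<le> b" "\<And>t. t \<in> {a..b} \<Longrightarrow> curve_deriv f 0 t {a..b}"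
  shows "f b = f a"
proof (rule ccontr)
  assume ne: "f b \<noteq> f a"
  then have ab: "a < b" using assms(1) by (cases "a = b") auto
  define z where "z = (1 / (b - a)) *\<^sub>R (f b - f a)"
  have "z \<noteq> 0" using ne ab by (simp add: z_def)
  then have "open (- {z})" "0 \<in> - {z}" by auto
  then obtain V where "open V" "0 \<in> V" "V \<subseteq> - {z}" "convex V"
    by (rule convex_open_nhd_zero)
  then show False
    using difference_quotient_in_convex[OF ab, of V f] assms(2) unfolding z_def by blast
qed

subsection \<open>Maps of class C1\<close>

lemma bastiani_smooth_C1: "bastiani_smooth f U \<Longrightarrow> bastiani_C 1 f U"
  by (simp add: bastiani_smooth_def)

lemma bastiani_C1_open: "bastiani_C 1 f U \<Longrightarrow> open U"
  by (simp add: bastiani_C_def)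

lemma bastiani_C1_dir_quotient:
  assumes "bastiani_C 1 f U" "x \<in> U"
  shows "(dir_quotient f x v \<longlongrightarrow> dir_deriv f x v) (at 0)"
proof -
  from assms obtain l where "(dir_quotient f x v \<longlongrightarrow> l) (at 0)"
    unfolding bastiani_C_def by (metis iter_deriv.simps(1) less_one list.size(3))
  moreover from this have "dir_deriv f x v = l"
    unfolding dir_deriv_def by (intro tendsto_Lim) auto
  ultimately show ?thesis by simp
qed

lemma bastiani_C1_dir_deriv_continuous_on:
  fixes f :: "'a::locally_convex_space \<Rightarrow> 'b::locally_convex_space"
  assumes "bastiani_C 1 f U" shows "continuous_on (U \<times> UNIV) (\<lambda>(x, v). dir_deriv f x v)"
proof -
  have *: "continuous_on (U \<times> (UNIV :: (nat \<Rightarrow> 'a) set)) (\<lambda>(x, w). iter_deriv f (map w [0..<1]) x)"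
    using assms unfolding bastiani_C_def by blast
  \<comment> \<open>A single direction enters the continuity clause of \<open>bastiani_C\<close> as
    a constant sequence.\<close>
  have "continuous_on (U \<times> (UNIV :: 'a set)) (\<lambda>p. (fst p, \<lambda>_::nat. snd p))"
    by (intro continuous_intros continuous_on_coordinatewise_then_product)
  from continuous_on_compose2[OF * this] have
    "continuous_on (U \<times> UNIV) (\<lambda>p. dir_deriv f (fst p) (snd p))"
    by fastforce
  then show ?thesis by (simp add: split_def)
qed

lemma tendsto_dir_deriv:
  fixes f :: "'a::locally_convex_space \<Rightarrow> 'b::locally_convex_space"
  assumes "bastiani_C 1 f U" "x \<in> U" "(y \<longlongrightarrow> x) F" "(w \<longlongrightarrow> v) F"
  shows "((\<lambda>i. dir_deriv f (y i) (w i)) \<longlongrightarrow> dir_deriv f x v) F"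
proof -
  have "open (U \<times> (UNIV :: 'a set))"
    using bastiani_C1_open[OF assms(1)] by (intro open_Times) auto
  with bastiani_C1_dir_deriv_continuous_on[OF assms(1)] assms(2)
  have "isCont (\<lambda>(x, v). dir_deriv f x v) (x, v)"
    by (simp add: continuous_on_eq_continuous_at)
  from isCont_tendsto_compose[OF this tendsto_Pair[OF assms(3,4)]] show ?thesis by simp
qed

lemma curve_deriv_segment:
  fixes f :: "'a::locally_convex_space \<Rightarrow> 'b::locally_convex_space"
  assumes "bastiani_C 1 f U" "y + s *\<^sub>R w \<in> U"
  shows "curve_deriv (\<lambda>s. f (y + s *\<^sub>R w)) (dir_deriv f (y + s *\<^sub>R w) w) s S"
proof -
  have "((\<lambda>r. dir_quotient f (y + s *\<^sub>R w) w (r - s)) \<longlongrightarrow> dir_deriv f (y + s *\<^sub>R w) w) (at s)"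
    using bastiani_C1_dir_quotient[OF assms, of w, THEN LIM_offset, of "-s"] by simp
  then have "((\<lambda>r. dir_quotient f (y + s *\<^sub>R w) w (r - s)) \<longlongrightarrow> dir_deriv f (y + s *\<^sub>R w) w) (at s within S)"
    by (rule tendsto_within_subset) simp
  moreover have "y + s *\<^sub>R w + (r - s) *\<^sub>R w = y + r *\<^sub>R w" for r
    by (simp add: algebra_simps)
  ultimately show ?thesis
    by (simp add: curve_deriv_def dir_quotient_def)
qed

text \<open>
  Continuity of the directional derivatives makes the difference quotients converge jointly in
  base point, direction and step, by the mean value theorem along segments.
\<close>

lemma dir_quotient_tendsto:
  fixes f :: "'a::locally_convex_space \<Rightarrow> 'b::locally_convex_space"
  assumes C1: "bastiani_C 1 f U" "x \<in> U"
    and lims: "(y \<longlongrightarrow> x) F" "(w \<longlongrightarrow> v) F" "(h \<longlongrightarrow> 0) F" and nz: "eventually (\<lambda>i. h i \<noteq> 0) F"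
  shows "((\<lambda>i. dir_quotient f (y i) (w i) (h i)) \<longlongrightarrow> dir_deriv f x v) F"
proof (rule topological_tendstoI)
  fix W assume "open W" "dir_deriv f x v \<in> W"
  then obtain V where V: "open V" "dir_deriv f x v \<in> V" "V \<subseteq> W" "convex V"
    by (rule convex_open_nhd)
  have "((\<lambda>(p::'a \<times> 'a \<times> real). fst p + snd (snd p) *\<^sub>R fst (snd p)) \<longlongrightarrow> x + 0 *\<^sub>R v) (nhds (x, v, 0))"
    by (intro tendsto_add tendsto_scaleR_lcs) (auto intro!: tendsto_eq_intros filterlim_ident)
  then have base: "((\<lambda>(p::'a \<times> 'a \<times> real). fst p + snd (snd p) *\<^sub>R fst (snd p)) \<longlongrightarrow> x) (nhds (x, v, 0))"
    by simp
  have dir: "((\<lambda>(p::'a \<times> 'a \<times> real). fst (snd p)) \<longlongrightarrow> v) (nhds (x, v, 0))"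
    by (auto intro!: tendsto_eq_intros filterlim_ident)
  have "eventually (\<lambda>p. fst p + snd (snd p) *\<^sub>R fst (snd p) \<in> U \<and>
      dir_deriv f (fst p + snd (snd p) *\<^sub>R fst (snd p)) (fst (snd p)) \<in> V) (nhds (x, v, 0))"
    using topological_tendstoD[OF base bastiani_C1_open[OF C1(1)] C1(2)]
      topological_tendstoD[OF tendsto_dir_deriv[OF C1 base dir] V(1,2)]
    by (rule eventually_conj)
  then obtain S where S: "open S" "(x, v, 0) \<in> S"
    "\<And>p. p \<in> S \<Longrightarrow> fst p + snd (snd p) *\<^sub>R fst (snd p) \<in> U \<and>
      dir_deriv f (fst p + snd (snd p) *\<^sub>R fst (snd p)) (fst (snd p)) \<in> V"
    unfolding eventually_nhds by auto
  obtain A B' where AB': "open A" "open B'" "(x, v, 0) \<in> A \<times> B'" "A \<times> B' \<subseteq> S"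
    using S(1,2) by (rule open_prod_elim)
  obtain B C where BC: "open B" "open C" "(v, 0) \<in> B \<times> C" "B \<times> C \<subseteq> B'"
    by (rule open_prod_elim[of B' "(v, 0)"]) (use AB' in auto)
  obtain d where d: "d > 0" "\<And>s. \<bar>s\<bar> < d \<Longrightarrow> s \<in> C"
    using BC open_real[of C] unfolding open_dist dist_real_def by auto
  have S': "y + s *\<^sub>R w \<in> U \<and> dir_deriv f (y + s *\<^sub>R w) w \<in> V" if "y \<in> A" "w \<in> B" "\<bar>s\<bar> < d" for y w s
  proof -
    have "(w, s) \<in> B'" using that(2) d(2)[OF that(3)] BC(4) by blast
    then have "(y, w, s) \<in> S" using that(1) AB'(4) by blast
    then show ?thesis using S(3) by fastforce
  qed
  have key: "dir_quotient f y w h \<in> V" if *: "y \<in> A" "w \<in> B" "\<bar>h\<bar> < d" "h \<noteq> 0" for y w h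
  proof -
    \<comment> \<open>The end points may lie on either side of 0, so that both signs of the step
      \<open>h\<close> are covered.\<close>
    have mv: "(1 / (b - a)) *\<^sub>R (f (y + b *\<^sub>R w) - f (y + a *\<^sub>R w)) \<in> V"
      if "a < b" "\<bar>a\<bar> < d" "\<bar>b\<bar> < d" for a b
    proof (rule difference_quotient_in_convex[OF that(1) V(1,4)])
      fix t assume "t \<in> {a..b}"
      then have "\<bar>t\<bar> < d" using that by auto
      from S'[OF *(1,2) this] curve_deriv_segment[OF C1(1)]
      show "\<exists>u\<in>V. curve_deriv (\<lambda>s. f (y + s *\<^sub>R w)) u t {a..b}" by blast
    qed
    show ?thesis
    proof (cases "h > 0")
      case True then show ?thesis using mv[of 0 h] d(1) * by (simp add: dir_quotient_def)
    next
      case False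
      moreover have "(1 / - h) *\<^sub>R (f y - f (y + h *\<^sub>R w)) = (1 / h) *\<^sub>R (f (y + h *\<^sub>R w) - f y)"
        using difference_quotient_sym[of 0 h] by simp
      ultimately show ?thesis using mv[of h 0] d(1) * by (simp add: dir_quotient_def)
    qed
  qed
  have "eventually (\<lambda>i. y i \<in> A) F" "eventually (\<lambda>i. w i \<in> B) F" "eventually (\<lambda>i. \<bar>h i\<bar> < d) F"
    using topological_tendstoD[OF lims(1) AB'(1)] topological_tendstoD[OF lims(2) BC(1)]
      tendstoD[OF lims(3) d(1)] AB' BC by (auto simp: dist_real_def)
  with nz have "eventually (\<lambda>i. dir_quotient f (y i) (w i) (h i) \<in> V) F"
    by eventually_elim (rule key)
  then show "eventually (\<lambda>i. dir_quotient f (y i) (w i) (h i) \<in> W) F"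
    by eventually_elim (use V(3) in auto)
qed

lemma at_within_eventually_diff_nonzero: "eventually (\<lambda>s::real. s - t \<noteq> 0) (at t within S)"
  by (auto simp: eventually_at intro!: exI[of _ 1])

text \<open>Chain rule. The quotient of the composite is the \<open>dir_quotient\<close> of
  \<open>f\<close> at \<open>c t\<close> in the direction of the quotient of \<open>c\<close>. This
  direction moves with \<open>s\<close>, so joint convergence of \<open>dir_quotient\<close> is
  needed.\<close>

lemma curve_deriv_C1:
  fixes f :: "'a::locally_convex_space \<Rightarrow> 'b::locally_convex_space"
  assumes "bastiani_C 1 f U" "c t \<in> U" "curve_deriv c v t S"
  shows "curve_deriv (\<lambda>s. f (c s)) (dir_deriv f (c t) v) t S"
proof -
  have "((\<lambda>s. s - t) \<longlongrightarrow> 0) (at t within S)"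
    by (auto intro!: tendsto_eq_intros)
  from dir_quotient_tendsto[OF assms(1,2) tendsto_const assms(3)[unfolded curve_deriv_def] this
      at_within_eventually_diff_nonzero]
  show ?thesis
    unfolding curve_deriv_def
    by (rule Lim_transform_eventually)
      (use at_within_eventually_diff_nonzero[of t S] in \<open>auto simp: dir_quotient_def elim: eventually_mono\<close>)
qed

lemma dir_deriv_eqI:
  assumes "curve_deriv (\<lambda>s. f (x + s *\<^sub>R v)) w 0 UNIV"
  shows "dir_deriv f x v = w"
proof -
  have "(\<lambda>s. (1 / (s - 0)) *\<^sub>R (f (x + s *\<^sub>R v) - f (x + 0 *\<^sub>R v))) = dir_quotient f x v"
    by (auto simp: dir_quotient_def)
  with assms have "(dir_quotient f x v \<longlongrightarrow> w) (at 0)"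
    by (simp add: curve_deriv_def)
  then show ?thesis unfolding dir_deriv_def by (intro tendsto_Lim) auto
qed

lemma dir_deriv_zero [simp]: "dir_deriv f x 0 = (0::'b::locally_convex_space)"
  by (rule dir_deriv_eqI) (simp add: curve_deriv_const)

text \<open>The step along \<open>v + w\<close> is split into a step along \<open>w\<close> from
  \<open>x\<close> and a step along \<open>v\<close> from the moved point
  \<open>x + h *\<^sub>R w\<close>; the second quotient converges because the base point may
  move.\<close>

lemma dir_deriv_add:
  fixes f :: "'a::locally_convex_space \<Rightarrow> 'b::locally_convex_space"
  assumes "bastiani_C 1 f U" "x \<in> U"
  shows "dir_deriv f x (v + w) = dir_deriv f x v + dir_deriv f x w"
proof (rule tendsto_unique)
  show "at (0::real) \<noteq> bot" by simp
  show "(dir_quotient f x (v + w) \<longlongrightarrow> dir_deriv f x (v + w)) (at 0)"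
    using assms by (rule bastiani_C1_dir_quotient)
  have "((\<lambda>h::real. x + h *\<^sub>R w) \<longlongrightarrow> x + 0 *\<^sub>R w) (at 0)"
    by (intro tendsto_add tendsto_scaleR_lcs tendsto_const tendsto_ident_at)
  then have "((\<lambda>h. dir_quotient f (x + h *\<^sub>R w) v h) \<longlongrightarrow> dir_deriv f x v) (at 0)"
    using at_within_eventually_diff_nonzero[of 0 UNIV]
    by (intro dir_quotient_tendsto[OF assms]) auto
  from tendsto_add[OF this bastiani_C1_dir_quotient[OF assms, of w]]
  moreover have "dir_quotient f (x + h *\<^sub>R w) v h + dir_quotient f x w h = dir_quotient f x (v + w) h" for h
  proof -
    have *: "x + h *\<^sub>R w + h *\<^sub>R v = x + h *\<^sub>R (v + w)" by (simp add: scaleR_add_right)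
    show ?thesis unfolding dir_quotient_def * by (simp add: scaleR_right_diff_distrib)
  qed
  ultimately show "(dir_quotient f x (v + w) \<longlongrightarrow> dir_deriv f x v + dir_deriv f x w) (at 0)"
    by simp
qed

lemma dir_deriv_scale:
  fixes f :: "'a::locally_convex_space \<Rightarrow> 'b::locally_convex_space"
  assumes "bastiani_C 1 f U" "x \<in> U"
  shows "dir_deriv f x (r *\<^sub>R v) = r *\<^sub>R dir_deriv f x v"
proof (rule dir_deriv_eqI)
  have "curve_deriv (\<lambda>s. f (x + s *\<^sub>R v)) (dir_deriv f x v) (r * 0) UNIV"
    using curve_deriv_segment[OF assms(1), of x 0 v UNIV] assms(2) by simp
  then have "curve_deriv (\<lambda>s. f (x + (r * s) *\<^sub>R v)) (r *\<^sub>R dir_deriv f x v) 0 UNIV"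
    by (rule curve_deriv_reparam) (auto intro!: derivative_eq_intros)
  then show "curve_deriv (\<lambda>s. f (x + s *\<^sub>R r *\<^sub>R v)) (r *\<^sub>R dir_deriv f x v) 0 UNIV"
    by (simp add: mult.commute)
qed

section \<open>Differentiating curves in a Lie group\<close>

context lie_group
begin

section \<open>Limits in charts and in the group\<close>

lemma in_carrier [simp]: "x \<in> carrier G"
  by (simp add: carrier_UNIV)

lemma chart_open: "c \<in> A \<Longrightarrow> open (fst c)" "c \<in> A \<Longrightarrow> open (snd c ` fst c)"
  using atlas by (auto simp: smooth_atlas_def)

lemma chart_homeomorphism:
  "c \<in> A \<Longrightarrow> homeomorphism (fst c) (snd c ` fst c) (snd c) (chart_inv c)"
  using atlas by (auto simp: smooth_atlas_def)

lemma chart_inv_chart [simp]: "c \<in> A \<Longrightarrow> g \<in> fst c \<Longrightarrow> chart_inv c (snd c g) = g"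
  by (rule homeomorphism_apply1[OF chart_homeomorphism])

lemma chart_chart_inv: "c \<in> A \<Longrightarrow> x \<in> snd c ` fst c \<Longrightarrow> snd c (chart_inv c x) = x"
  by (rule homeomorphism_apply2[OF chart_homeomorphism])

lemma chart_exists: obtains c where "c \<in> A" "g \<in> fst c"
proof -
  have "g \<in> \<Union>(fst ` A)" using atlas by (simp add: smooth_atlas_def)
  with that show thesis by blast
qed

lemma tendsto_chart:
  assumes "c \<in> A" "g \<in> fst c" "(p \<longlongrightarrow> g) F"
  shows "((\<lambda>s. snd c (p s)) \<longlongrightarrow> snd c g) F"
proof -
  have "isCont (snd c) g"
    using chart_homeomorphism[OF assms(1)] chart_open(1)[OF assms(1)] assms(2)
    by (simp add: homeomorphism_def continuous_on_eq_continuous_at)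
  from isCont_tendsto_compose[OF this assms(3)] show ?thesis .
qed

lemma tendsto_chart_inv:
  assumes "c \<in> A" "x \<in> snd c ` fst c" "(p \<longlongrightarrow> x) F"
  shows "((\<lambda>s. chart_inv c (p s)) \<longlongrightarrow> chart_inv c x) F"
proof -
  have "isCont (chart_inv c) x"
    using chart_homeomorphism[OF assms(1)] chart_open(2)[OF assms(1)] assms(2)
    unfolding homeomorphism_def using continuous_on_eq_continuous_at by blast
  from isCont_tendsto_compose[OF this assms(3)] show ?thesis .
qed

lemma tendsto_mult_group:
  assumes "(p \<longlongrightarrow> g) F" "(q \<longlongrightarrow> h) F"
  shows "((\<lambda>s. p s \<otimes> q s) \<longlongrightarrow> g \<otimes> h) F"
proof -
  have "isCont (\<lambda>(x, y). x \<otimes> y) (g, h)"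
    using continuous_mult by (simp add: continuous_on_eq_continuous_at)
  from isCont_tendsto_compose[OF this tendsto_Pair[OF assms]] show ?thesis by simp
qed

lemma tendsto_inv_group:
  assumes "(p \<longlongrightarrow> g) F"
  shows "((\<lambda>s. inv (p s)) \<longlongrightarrow> inv g) F"
proof -
  have "isCont (\<lambda>x. inv x) g"
    using continuous_inverse by (simp add: continuous_on_eq_continuous_at)
  from isCont_tendsto_compose[OF this assms] show ?thesis .
qed

text \<open>\<open>snd c\<close> is arbitrary off \<open>fst c\<close>, so a derivative of the
  coordinates alone would not keep \<open>p\<close> near \<open>p t\<close>. Continuity of
  \<open>p\<close> is therefore part of the notion.\<close>

definition chart_deriv ::
    "('g, 'e) chart \<Rightarrow> (real \<Rightarrow> 'g) \<Rightarrow> 'e \<Rightarrow> real \<Rightarrow> real set \<Rightarrow> bool" where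
  "chart_deriv c p v t S \<longleftrightarrow> c \<in> A \<and> p t \<in> fst c \<and> (p \<longlongrightarrow> p t) (at t within S) \<and>
     curve_deriv (\<lambda>s. snd c (p s)) v t S"

lemma chart_deriv_continuous: "chart_deriv c p v t S \<Longrightarrow> (p \<longlongrightarrow> p t) (at t within S)"
  by (simp add: chart_deriv_def)

lemma chart_deriv_eventually:
  "chart_deriv c p v t S \<Longrightarrow> eventually (\<lambda>s. p s \<in> fst c) (at t within S)"
  using chart_open(1) topological_tendstoD unfolding chart_deriv_def by blast

lemma chart_deriv_const: "c \<in> A \<Longrightarrow> g \<in> fst c \<Longrightarrow> chart_deriv c (\<lambda>_. g) 0 t S"
  by (simp add: chart_deriv_def curve_deriv_const)

lemma chart_deriv_mono: "chart_deriv c p v t S \<Longrightarrow> T \<subseteq> S \<Longrightarrow> chart_deriv c p v t T"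
  unfolding chart_deriv_def using curve_deriv_mono tendsto_within_subset by blast

lemma chart_deriv_unique:
  "chart_deriv c p v t S \<Longrightarrow> chart_deriv c p w t S \<Longrightarrow> at t within S \<noteq> bot \<Longrightarrow> v = w"
  unfolding chart_deriv_def using curve_deriv_unique by blast

lemma chart_deriv_cong:
  assumes "chart_deriv c p v t S" "eventually (\<lambda>s. p s = q s) (at t within S)" "p t = q t"
  shows "chart_deriv c q v t S"
proof -
  have "(q \<longlongrightarrow> q t) (at t within S)"
    using assms Lim_transform_eventually unfolding chart_deriv_def by fastforce
  moreover have "curve_deriv (\<lambda>s. snd c (q s)) v t S"
    using assms(1) unfolding chart_deriv_def
    by (elim conjE, elim curve_deriv_cong) (use assms(2,3) in \<open>auto elim: eventually_mono\<close>)
  ultimately show ?thesis using assms(1,3) by (simp add: chart_deriv_def)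
qed

lemma chart_deriv_reparam:
  assumes "chart_deriv c p v (f t) T" "(f has_real_derivative d) (at t within S)" "f ` S \<subseteq> T"
  shows "chart_deriv c (\<lambda>s. p (f s)) (d *\<^sub>R v) t S"
proof -
  have "continuous (at (f t) within f ` S) p"
    using assms(1,3) continuous_within_subset unfolding chart_deriv_def continuous_within by blast
  then have "continuous (at t within S) (p \<circ> f)"
    using DERIV_continuous[OF assms(2)] by (intro continuous_within_compose)
  with assms show ?thesis
    using curve_deriv_reparam[of "\<lambda>s. snd c (p s)" v f t T d S]
    by (simp add: chart_deriv_def continuous_within comp_def)
qed

lemma chart_change_C1:
  assumes "c \<in> A" "d \<in> A"
  shows "bastiani_C 1 (snd d \<circ> chart_inv c) (snd c ` (fst c \<inter> fst d))"
  using atlas assms by (intro bastiani_smooth_C1) (auto simp: smooth_atlas_def)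

lemma chart_deriv_change:
  assumes p: "chart_deriv c p v t S" and d: "d \<in> A" "p t \<in> fst d"
  shows "chart_deriv d p (dir_deriv (snd d \<circ> chart_inv c) (snd c (p t)) v) t S"
proof -
  have c: "c \<in> A" "p t \<in> fst c" using p by (auto simp: chart_deriv_def)
  have "curve_deriv (\<lambda>s. (snd d \<circ> chart_inv c) (snd c (p s)))
      (dir_deriv (snd d \<circ> chart_inv c) (snd c (p t)) v) t S"
    by (rule curve_deriv_C1[OF chart_change_C1[OF c(1) d(1)]]) (use p c d in \<open>auto simp: chart_deriv_def\<close>)
  then have "curve_deriv (\<lambda>s. snd d (p s)) (dir_deriv (snd d \<circ> chart_inv c) (snd c (p t)) v) t S"
    by (rule curve_deriv_cong)
      (use chart_deriv_eventually[OF p] c in \<open>auto elim!: eventually_mono\<close>)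
  with p d show ?thesis by (simp add: chart_deriv_def)
qed

section \<open>Multiplication and inversion in charts\<close>

definition chart_mult ::
    "('g, 'e) chart \<Rightarrow> ('g, 'e) chart \<Rightarrow> ('g, 'e) chart \<Rightarrow> 'e \<times> 'e \<Rightarrow> 'e" where
  "chart_mult c d r = (\<lambda>(x, y). snd r (chart_inv c x \<otimes> chart_inv d y))"

definition chart_mult_dom ::
    "('g, 'e) chart \<Rightarrow> ('g, 'e) chart \<Rightarrow> ('g, 'e) chart \<Rightarrow> ('e \<times> 'e) set" where
  "chart_mult_dom c d r =
     {(x, y). x \<in> snd c ` fst c \<and> y \<in> snd d ` fst d \<and> chart_inv c x \<otimes> chart_inv d y \<in> fst r}"

text \<open>The differential of multiplication at \<open>(g, h)\<close> in coordinates. With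
  \<open>w = 0\<close> it is that of right translation by \<open>h\<close>, with
  \<open>v = 0\<close> that of left translation by \<open>g\<close>.\<close>

definition mult_deriv ::
    "('g, 'e) chart \<Rightarrow> ('g, 'e) chart \<Rightarrow> ('g, 'e) chart \<Rightarrow> 'g \<Rightarrow> 'g \<Rightarrow> 'e \<Rightarrow> 'e \<Rightarrow> 'e" where
  "mult_deriv c d r g h v w = dir_deriv (chart_mult c d r) (snd c g, snd d h) (v, w)"

lemma chart_mult_C1:
  "c \<in> A \<Longrightarrow> d \<in> A \<Longrightarrow> r \<in> A \<Longrightarrow> bastiani_C 1 (chart_mult c d r) (chart_mult_dom c d r)"
  unfolding chart_mult_def chart_mult_dom_def using smooth_mult bastiani_smooth_C1 by blast

lemma chart_mult_domI:
  "c \<in> A \<Longrightarrow> d \<in> A \<Longrightarrow> g \<in> fst c \<Longrightarrow> h \<in> fst d \<Longrightarrow> g \<otimes> h \<in> fst r \<Longrightarrow>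
    (snd c g, snd d h) \<in> chart_mult_dom c d r"
  by (auto simp: chart_mult_dom_def)

lemma chart_deriv_mult:
  assumes p: "chart_deriv c p v t S" and q: "chart_deriv d q w t S"
    and r: "r \<in> A" "p t \<otimes> q t \<in> fst r"
  shows "chart_deriv r (\<lambda>s. p s \<otimes> q s) (mult_deriv c d r (p t) (q t) v w) t S"
proof -
  have cd: "c \<in> A" "p t \<in> fst c" "d \<in> A" "q t \<in> fst d"
    using p q by (auto simp: chart_deriv_def)
  have "curve_deriv (\<lambda>s. (snd c (p s), snd d (q s))) (v, w) t S"
    using p q by (simp add: chart_deriv_def curve_deriv_Pair)
  from curve_deriv_C1[OF chart_mult_C1[OF cd(1,3) r(1)] chart_mult_domI[OF cd(1,3,2,4) r(2)] this]
  have "curve_deriv (\<lambda>s. chart_mult c d r (snd c (p s), snd d (q s)))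
      (mult_deriv c d r (p t) (q t) v w) t S"
    by (simp add: mult_deriv_def)
  moreover have "eventually (\<lambda>s. chart_mult c d r (snd c (p s), snd d (q s)) = snd r (p s \<otimes> q s))
      (at t within S)"
    using chart_deriv_eventually[OF p] chart_deriv_eventually[OF q]
    by eventually_elim (simp add: chart_mult_def cd)
  ultimately have "curve_deriv (\<lambda>s. snd r (p s \<otimes> q s)) (mult_deriv c d r (p t) (q t) v w) t S"
    by (rule curve_deriv_cong) (simp add: chart_mult_def cd)
  then show ?thesis
    using r tendsto_mult_group[OF chart_deriv_continuous[OF p] chart_deriv_continuous[OF q]]
    by (simp add: chart_deriv_def)
qed

text \<open>Existence is enough: at the unit the value is recovered by differentiating the constant
  product of the curve with its inverse.\<close>

lemma chart_deriv_inv: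
  assumes p: "chart_deriv c p v t S" and d: "d \<in> A" "inv (p t) \<in> fst d"
  shows "\<exists>w. chart_deriv d (\<lambda>s. inv (p s)) w t S"
proof -
  have c: "c \<in> A" "p t \<in> fst c" using p by (auto simp: chart_deriv_def)
  define f where "f = (\<lambda>x. snd d (inv (chart_inv c x)))"
  have "bastiani_C 1 f {x \<in> snd c ` fst c. inv (chart_inv c x) \<in> fst d}"
    unfolding f_def using smooth_inverse c d bastiani_smooth_C1 by blast
  then have "curve_deriv (\<lambda>s. f (snd c (p s))) (dir_deriv f (snd c (p t)) v) t S"
    by (rule curve_deriv_C1) (use p c d in \<open>auto simp: chart_deriv_def\<close>)
  then have "curve_deriv (\<lambda>s. snd d (inv (p s))) (dir_deriv f (snd c (p t)) v) t S"
    by (rule curve_deriv_cong)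
      (use chart_deriv_eventually[OF p] c in \<open>auto elim!: eventually_mono simp: f_def\<close>)
  with d tendsto_inv_group p show ?thesis by (auto simp: chart_deriv_def)
qed

text \<open>Every coordinate vector is the derivative of a curve in the group. Identities between
  differentials can thus be proved by differentiating one curve in two ways.\<close>

lemma chart_deriv_line:
  assumes "c \<in> A" "g \<in> fst c"
  shows "chart_deriv c (\<lambda>s. chart_inv c (snd c g + s *\<^sub>R v)) v 0 S"
proof -
  have "((\<lambda>s::real. snd c g + s *\<^sub>R v) \<longlongrightarrow> snd c g + 0 *\<^sub>R v) (at 0 within S)"
    by (intro tendsto_add tendsto_scaleR_lcs tendsto_const tendsto_ident_at)
  then have lim: "((\<lambda>s::real. snd c g + s *\<^sub>R v) \<longlongrightarrow> snd c g) (at 0 within S)" by simp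
  have "eventually (\<lambda>s. snd c g + s *\<^sub>R v \<in> snd c ` fst c) (at 0 within S)"
    using topological_tendstoD[OF lim chart_open(2)] assms by auto
  then have "curve_deriv (\<lambda>s. snd c (chart_inv c (snd c g + s *\<^sub>R v))) v 0 S"
    by (intro curve_deriv_cong[OF curve_deriv_line[of "snd c g"]])
      (use assms in \<open>auto elim!: eventually_mono simp: chart_chart_inv\<close>)
  moreover have "((\<lambda>s. chart_inv c (snd c g + s *\<^sub>R v)) \<longlongrightarrow> chart_inv c (snd c g)) (at 0 within S)"
    using assms lim by (intro tendsto_chart_inv) auto
  ultimately show ?thesis using assms by (simp add: chart_deriv_def)
qed

lemma mult_deriv_add:
  assumes "c \<in> A" "d \<in> A" "r \<in> A" "g \<in> fst c" "h \<in> fst d" "g \<otimes> h \<in> fst r"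
  shows "mult_deriv c d r g h (v + v') (w + w') = mult_deriv c d r g h v w + mult_deriv c d r g h v' w'"
  unfolding mult_deriv_def
  using dir_deriv_add[OF chart_mult_C1 chart_mult_domI, OF assms(1-3,1,2,4-6), of "(v, w)" "(v', w')"]
  by simp

lemma mult_deriv_scale:
  assumes "c \<in> A" "d \<in> A" "r \<in> A" "g \<in> fst c" "h \<in> fst d" "g \<otimes> h \<in> fst r"
  shows "mult_deriv c d r g h (a *\<^sub>R v) (a *\<^sub>R w) = a *\<^sub>R mult_deriv c d r g h v w"
  unfolding mult_deriv_def
  using dir_deriv_scale[OF chart_mult_C1 chart_mult_domI, OF assms(1-3,1,2,4-6), of a "(v, w)"]
  by simp

lemma mult_deriv_zero: "mult_deriv c d r g h 0 0 = 0"
  unfolding mult_deriv_def using dir_deriv_zero by (metis zero_prod_def)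

lemma tendsto_mult_deriv:
  assumes "c \<in> A" "d \<in> A" "r \<in> A" "g \<in> fst c" "h \<in> fst d" "g \<otimes> h \<in> fst r"
    and "(p \<longlongrightarrow> g) F" "(q \<longlongrightarrow> h) F" "(x \<longlongrightarrow> v) F" "(y \<longlongrightarrow> w) F"
  shows "((\<lambda>i. mult_deriv c d r (p i) (q i) (x i) (y i)) \<longlongrightarrow> mult_deriv c d r g h v w) F"
  unfolding mult_deriv_def
  using assms by (intro tendsto_dir_deriv[OF chart_mult_C1 chart_mult_domI] tendsto_Pair tendsto_chart)

subsection \<open>The right logarithmic derivative in a chart at the unit\<close>

text \<open>Fixing one chart at the unit identifies the Lie algebra with \<open>'e\<close>, so that
  logarithmic derivatives become curves in \<open>'e\<close>.\<close>

definition unit_chart :: "('g, 'e) chart" where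
  "unit_chart = (SOME c. c \<in> charts_at A \<one>)"

lemma unit_chart: "unit_chart \<in> A" "\<one> \<in> fst unit_chart"
proof -
  obtain c where "c \<in> A" "\<one> \<in> fst c" by (rule chart_exists)
  then have "c \<in> charts_at A \<one>" by (simp add: charts_at_def)
  then have "\<exists>c. c \<in> charts_at A \<one>" by (rule exI)
  from someI_ex[OF this] show "unit_chart \<in> A" "\<one> \<in> fst unit_chart"
    by (auto simp: unit_chart_def charts_at_def)
qed

text \<open>By additivity it suffices to multiply a coordinate line by the constant unit on either
  side, which does not change the line.\<close>

lemma mult_deriv_unit:
  "mult_deriv unit_chart unit_chart unit_chart \<one> \<one> v w = v + w"
proof -
  let ?c = unit_chart and ?one = "\<lambda>_::real. \<one>"
  let ?l = "\<lambda>v s. chart_inv ?c (snd ?c \<one> + s *\<^sub>R v)"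
  have l: "chart_deriv ?c (?l v) v 0 UNIV" for v
    by (rule chart_deriv_line) (rule unit_chart)+
  have c: "chart_deriv ?c ?one 0 0 UNIV"
    by (rule chart_deriv_const) (rule unit_chart)+
  have "mult_deriv ?c ?c ?c \<one> \<one> v 0 = v"
    using chart_deriv_mult[OF l[of v] c unit_chart(1)] unit_chart l[of v]
    by (intro chart_deriv_unique[OF _ l]) auto
  moreover have "mult_deriv ?c ?c ?c \<one> \<one> 0 w = w"
    using chart_deriv_mult[OF c l[of w] unit_chart(1)] unit_chart l[of w]
    by (intro chart_deriv_unique[OF _ l]) auto
  ultimately show ?thesis
    using mult_deriv_add[of ?c ?c ?c \<one> \<one> v 0 0 w] unit_chart by simp
qed

lemma chart_deriv_mult_unit:
  assumes "chart_deriv unit_chart p v t S" "chart_deriv unit_chart q w t S" "p t = \<one>" "q t = \<one>"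
  shows "chart_deriv unit_chart (\<lambda>s. p s \<otimes> q s) (v + w) t S"
  using chart_deriv_mult[OF assms(1,2) unit_chart(1)] assms(3,4) unit_chart(2)
  by (simp add: mult_deriv_unit)

lemma chart_deriv_inv_unit:
  assumes p: "chart_deriv unit_chart p v t S" "p t = \<one>"
  shows "chart_deriv unit_chart (\<lambda>s. inv (p s)) (- v) t S"
proof -
  obtain w where w: "chart_deriv unit_chart (\<lambda>s. inv (p s)) w t S"
    using chart_deriv_inv[OF p(1) unit_chart(1)] p(2) unit_chart(2) by auto
  have "chart_deriv unit_chart (\<lambda>s. \<one>) (v + w) t S"
    using chart_deriv_mult_unit[OF p(1) w] p(2) by simp
  moreover have "chart_deriv unit_chart (\<lambda>s. \<one>) 0 t S"
    by (rule chart_deriv_const) (rule unit_chart)+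
  ultimately have "at t within S \<noteq> bot \<Longrightarrow> w = - v"
    using chart_deriv_unique by (metis add_eq_0_iff)
  then show ?thesis
    using w by (cases "at t within S = bot") (auto simp: chart_deriv_def curve_deriv_def)
qed

section \<open>The adjoint action\<close>

definition Ad :: "'g \<Rightarrow> 'e \<Rightarrow> 'e" where
  "Ad g v = dir_deriv (\<lambda>x. snd unit_chart (g \<otimes> chart_inv unit_chart x \<otimes> inv g)) (snd unit_chart \<one>) v"

lemma chart_deriv_conj_charts:
  assumes p: "chart_deriv unit_chart p v t S" "p t = \<one>"
    and cd: "c \<in> A" "g \<in> fst c" "d \<in> A" "inv g \<in> fst d"
  shows "chart_deriv unit_chart (\<lambda>s. g \<otimes> p s \<otimes> inv g)
      (mult_deriv c d unit_chart g (inv g) (mult_deriv c unit_chart c g \<one> 0 v) 0) t S"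
proof -
  have "chart_deriv c (\<lambda>s. g \<otimes> p s) (mult_deriv c unit_chart c g \<one> 0 v) t S"
    using chart_deriv_mult[OF chart_deriv_const[OF cd(1,2)] p(1) cd(1)] cd p(2) by simp
  from chart_deriv_mult[OF this chart_deriv_const[OF cd(3,4)] unit_chart(1)]
  show ?thesis using unit_chart(2) p(2) by simp
qed

text \<open>Conjugation is left translation by \<open>g\<close> followed by right translation by
  \<open>inv g\<close>. The charts \<open>c\<close> and \<open>d\<close> also serve for nearby group
  elements, so linearity and joint continuity of \<open>Ad\<close> are inherited from
  \<open>mult_deriv\<close>.\<close>

lemma Ad_charts:
  assumes cd: "c \<in> A" "g \<in> fst c" "d \<in> A" "inv g \<in> fst d"
  shows "Ad g v = mult_deriv c d unit_chart g (inv g) (mult_deriv c unit_chart c g \<one> 0 v) 0"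
  unfolding Ad_def
proof (rule dir_deriv_eqI)
  show "curve_deriv (\<lambda>s. snd unit_chart (g \<otimes> chart_inv unit_chart (snd unit_chart \<one> + s *\<^sub>R v) \<otimes> inv g))
      (mult_deriv c d unit_chart g (inv g) (mult_deriv c unit_chart c g \<one> 0 v) 0) 0 UNIV"
    using chart_deriv_conj_charts[OF chart_deriv_line[OF unit_chart] _ cd] unit_chart
    by (simp add: chart_deriv_def)
qed

lemma chart_deriv_conj:
  assumes "chart_deriv unit_chart p v t S" "p t = \<one>"
  shows "chart_deriv unit_chart (\<lambda>s. g \<otimes> p s \<otimes> inv g) (Ad g v) t S"
  using chart_deriv_conj_charts[OF assms] Ad_charts chart_exists by metis

lemma Ad_add: "Ad g (v + w) = Ad g v + Ad g w"
proof -
  obtain c d where cd: "c \<in> A" "g \<in> fst c" "d \<in> A" "inv g \<in> fst d"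
    using chart_exists by metis
  show ?thesis
    using mult_deriv_add[of c unit_chart c g \<one> 0 0 v w] mult_deriv_add[of c d unit_chart g "inv g" _ _ 0 0]
      cd unit_chart by (simp add: Ad_charts[OF cd])
qed

lemma Ad_scale: "Ad g (a *\<^sub>R v) = a *\<^sub>R Ad g v"
proof -
  obtain c d where cd: "c \<in> A" "g \<in> fst c" "d \<in> A" "inv g \<in> fst d"
    using chart_exists by metis
  show ?thesis
    using mult_deriv_scale[of c unit_chart c g \<one> a 0 v] mult_deriv_scale[of c d unit_chart g "inv g" a _ 0]
      cd unit_chart by (simp add: Ad_charts[OF cd])
qed

lemma tendsto_Ad:
  assumes p: "(p \<longlongrightarrow> g) F" and x: "(x \<longlongrightarrow> v) F"
  shows "((\<lambda>i. Ad (p i) (x i)) \<longlongrightarrow> Ad g v) F"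
proof -
  obtain c d where cd: "c \<in> A" "g \<in> fst c" "d \<in> A" "inv g \<in> fst d"
    using chart_exists by metis
  note ip = tendsto_inv_group[OF p]
  have "((\<lambda>i. mult_deriv c d unit_chart (p i) (inv (p i)) (mult_deriv c unit_chart c (p i) \<one> 0 (x i)) 0)
      \<longlongrightarrow> Ad g v) F"
    unfolding Ad_charts[OF cd] using cd unit_chart
    by (intro tendsto_mult_deriv p x ip tendsto_const) auto
  moreover have "eventually (\<lambda>i. p i \<in> fst c) F" "eventually (\<lambda>i. inv (p i) \<in> fst d) F"
    using topological_tendstoD[OF p chart_open(1)[OF cd(1)] cd(2)]
      topological_tendstoD[OF ip chart_open(1)[OF cd(3)] cd(4)] .
  then have "eventually (\<lambda>i. mult_deriv c d unit_chart (p i) (inv (p i))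
      (mult_deriv c unit_chart c (p i) \<one> 0 (x i)) 0 = Ad (p i) (x i)) F"
    by eventually_elim (use cd Ad_charts in auto)
  ultimately show ?thesis by (rule Lim_transform_eventually)
qed

text \<open>The right logarithmic derivative in coordinates. Moving \<open>\<mu> t\<close> to the
  unit before differentiating lets one chart serve all \<open>t\<close>.\<close>

definition has_log_deriv :: "(real \<Rightarrow> 'g) \<Rightarrow> 'e \<Rightarrow> real \<Rightarrow> real set \<Rightarrow> bool" where
  "has_log_deriv \<mu> v t S \<longleftrightarrow> chart_deriv unit_chart (\<lambda>s. \<mu> s \<otimes> inv (\<mu> t)) v t S"

lemma has_log_deriv_mono: "has_log_deriv \<mu> v t S \<Longrightarrow> T \<subseteq> S \<Longrightarrow> has_log_deriv \<mu> v t T"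
  unfolding has_log_deriv_def by (rule chart_deriv_mono)

lemma has_log_deriv_unique:
  "has_log_deriv \<mu> v t S \<Longrightarrow> has_log_deriv \<mu> w t S \<Longrightarrow> at t within S \<noteq> bot \<Longrightarrow> v = w"
  unfolding has_log_deriv_def by (rule chart_deriv_unique)

lemma has_log_deriv_cong:
  assumes "has_log_deriv \<mu> v t S" "eventually (\<lambda>s. \<mu> s = \<nu> s) (at t within S)" "\<mu> t = \<nu> t"
  shows "has_log_deriv \<nu> v t S"
  using assms(1) unfolding has_log_deriv_def
  by (rule chart_deriv_cong) (use assms(2,3) in \<open>auto elim: eventually_mono\<close>)

lemma has_log_deriv_const: "has_log_deriv (\<lambda>_. g) 0 t S"
  unfolding has_log_deriv_def by (rule chart_deriv_const) (simp_all add: unit_chart)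

text \<open>The factor \<open>g\<close> cancels in the quotient of two values of the curve. This is
  what allows pieces to be joined end to end with unchanged logarithmic derivatives.\<close>

lemma has_log_deriv_translate:
  "has_log_deriv \<mu> v t S \<Longrightarrow> has_log_deriv (\<lambda>s. \<mu> s \<otimes> g) v t S"
  unfolding has_log_deriv_def by (simp add: inv_mult_group m_assoc m_assoc[of g "inv g", symmetric])

lemma has_log_deriv_reparam:
  "has_log_deriv \<mu> v (f t) T \<Longrightarrow> (f has_real_derivative d) (at t within S) \<Longrightarrow> f ` S \<subseteq> T \<Longrightarrow>
    has_log_deriv (\<lambda>s. \<mu> (f s)) (d *\<^sub>R v) t S"
  unfolding has_log_deriv_def by (rule chart_deriv_reparam)

lemma chart_deriv_has_log_deriv:
  assumes "chart_deriv c \<mu> v t S" "d \<in> A" "inv (\<mu> t) \<in> fst d"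
  shows "has_log_deriv \<mu> (mult_deriv c d unit_chart (\<mu> t) (inv (\<mu> t)) v 0) t S"
  unfolding has_log_deriv_def
  using chart_deriv_mult[OF assms(1) chart_deriv_const[OF assms(2,3)] unit_chart(1)] unit_chart(2)
  by simp

lemma has_log_deriv_chart_deriv:
  assumes "has_log_deriv \<mu> v t S" "c \<in> A" "\<mu> t \<in> fst c"
  shows "chart_deriv c \<mu> (mult_deriv unit_chart c c \<one> (\<mu> t) v 0) t S"
  using chart_deriv_mult[OF assms(1)[unfolded has_log_deriv_def] chart_deriv_const[OF assms(2,3)] assms(2)]
    assms(3) by (simp add: m_assoc)

lemma has_log_deriv_continuous:
  assumes "has_log_deriv \<mu> v t S" shows "(\<mu> \<longlongrightarrow> \<mu> t) (at t within S)"
  using chart_exists has_log_deriv_chart_deriv[OF assms] chart_deriv_continuous by metis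

text \<open>Translated to the unit, the quotient curve is the conjugate by \<open>inv (e t)\<close>
  of the product of two curves through the unit, one of them inverted. There derivatives of products
  add and those of inverses change sign.\<close>

lemma has_log_deriv_quotient:
  assumes e: "has_log_deriv e v t S" and m: "has_log_deriv m w t S"
  shows "has_log_deriv (\<lambda>s. inv (e s) \<otimes> m s) (Ad (inv (e t)) (w - v)) t S"
proof -
  have "chart_deriv unit_chart (\<lambda>s. inv (e s \<otimes> inv (e t)) \<otimes> (m s \<otimes> inv (m t))) (- v + w) t S"
    using e m unfolding has_log_deriv_def
    by (intro chart_deriv_mult_unit chart_deriv_inv_unit) simp_all
  from chart_deriv_conj[OF this, of "inv (e t)"]
  have "chart_deriv unit_chart
      (\<lambda>s. inv (e t) \<otimes> (inv (e s \<otimes> inv (e t)) \<otimes> (m s \<otimes> inv (m t))) \<otimes> inv (inv (e t)))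
      (Ad (inv (e t)) (- v + w)) t S"
    by simp
  moreover have "inv (e t) \<otimes> (inv (e s \<otimes> inv (e t)) \<otimes> (m s \<otimes> inv (m t))) \<otimes> inv (inv (e t))
      = inv (e s) \<otimes> m s \<otimes> inv (inv (e t) \<otimes> m t)" for s
    by (simp add: inv_mult_group m_assoc[symmetric])
  ultimately show ?thesis by (simp add: has_log_deriv_def)
qed

text \<open>Near each parameter the curve stays in one chart, where a zero logarithmic derivative
  means a zero coordinate derivative. Local constancy is globalized by bisection.\<close>

lemma zero_log_deriv_constant:
  assumes "a \<le> b" and d0: "\<And>t. t \<in> {a..b} \<Longrightarrow> has_log_deriv \<mu> 0 t {a..b}"
  shows "\<mu> b = \<mu> a"
proof -
  define P where "P x y \<longleftrightarrow> (a \<le> x \<longrightarrow> x \<le> y \<longrightarrow> y \<le> b \<longrightarrow> \<mu> y = \<mu> x)" for x y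
  have "P a b" using assms(1)
  proof (induct rule: Bolzano)
    case (trans x y z)
    then show ?case by (auto simp: P_def)
  next
    case (local x)
    obtain c where c: "c \<in> A" "\<mu> x \<in> fst c" by (rule chart_exists)
    have "eventually (\<lambda>s. \<mu> s \<in> fst c) (at x within {a..b})"
      using local has_log_deriv_continuous[OF d0] chart_open(1)[OF c(1)] c(2) topological_tendstoD by fastforce
    then obtain d where d: "d > 0" "\<And>s. s \<in> {a..b} \<Longrightarrow> s \<noteq> x \<Longrightarrow> \<bar>s - x\<bar> < d \<Longrightarrow> \<mu> s \<in> fst c"
      by (auto simp: eventually_at dist_real_def)
    have "P y z" if "y \<le> x" "x \<le> z" "z - y < d" for y z
      unfolding P_def
    proof (intro impI)
      assume yz: "a \<le> y" "y \<le> z" "z \<le> b"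
      have mem: "\<mu> s \<in> fst c" if "s \<in> {y..z}" for s
        using d(2)[of s] c(2) that \<open>z - y < d\<close> \<open>y \<le> x\<close> \<open>x \<le> z\<close> yz by (cases "s = x") auto
      have "curve_deriv (\<lambda>s. snd c (\<mu> s)) 0 s {y..z}" if "s \<in> {y..z}" for s
      proof -
        have "has_log_deriv \<mu> 0 s {y..z}"
          using d0[of s] that yz by (auto intro: has_log_deriv_mono)
        from has_log_deriv_chart_deriv[OF this c(1) mem[OF that]]
        show ?thesis by (simp add: chart_deriv_def mult_deriv_zero)
      qed
      from zero_curve_deriv_constant[OF yz(2) this] have "snd c (\<mu> z) = snd c (\<mu> y)" by blast
      then have "chart_inv c (snd c (\<mu> z)) = chart_inv c (snd c (\<mu> y))" by simp
      then show "\<mu> z = \<mu> y"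
        using chart_inv_chart[OF c(1)] mem[of y] mem[of z] yz(2) by simp
    qed
    then show ?case using d(1) by blast
  qed
  then show ?thesis using assms(1) by (simp add: P_def)
qed

end

section \<open>Logarithmic derivatives and evolutions\<close>

text \<open>C1 curves are defined through \<open>bastiani_C\<close> on subsets of the line; this
  instance makes the calculus applicable to them.\<close>

instance real :: locally_convex_space
proof
  fix a x :: real
  show "((\<lambda>p. fst p *\<^sub>R snd p) \<longlongrightarrow> a *\<^sub>R x) (nhds a \<times>\<^sub>F nhds x)"
    by (intro tendsto_scaleR filterlim_fst filterlim_snd)
next
  fix U :: "real set" assume "open U" "0 \<in> U"
  then obtain e where e: "e > 0" "ball 0 e \<subseteq> U" by (auto simp: open_contains_ball)
  have "convex (ball (0::real) e)" by (rule convex_ball)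
  with e show "\<exists>V. open V \<and> 0 \<in> V \<and> V \<subseteq> U \<and>
      (\<forall>x\<in>V. \<forall>y\<in>V. \<forall>u\<ge>0. \<forall>v\<ge>0. u + v = 1 \<longrightarrow> u *\<^sub>R x + v *\<^sub>R y \<in> V)"
    by (intro exI[of _ "ball 0 e"]) (simp only: open_ball convex_def centre_in_ball simp_thms)
qed

lemma at_within_unit_interval: "t \<in> {0..1} \<Longrightarrow> at t within {0..1::real} \<noteq> bot"
  using islimpt_Icc[of 0 "1::real" t] by (simp add: trivial_limit_within)

context lie_group
begin

section \<open>Tangent vectors at the unit, recovered from their coordinates in
  \<open>unit_chart\<close>\<close>

definition tvec_of :: "'e \<Rightarrow> ('g, 'e) tvec" where
  "tvec_of v = (\<lambda>c. if c \<in> charts_at A \<one>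
     then dir_deriv (snd c \<circ> chart_inv unit_chart) (snd unit_chart \<one>) v else 0)"

lemma unit_chart_at: "unit_chart \<in> charts_at A \<one>"
  using unit_chart by (simp add: charts_at_def)

lemma chart_deriv_tvec_of:
  assumes "chart_deriv unit_chart p v t S" "p t = \<one>" "c \<in> charts_at A \<one>"
  shows "chart_deriv c p (tvec_of v c) t S"
  using chart_deriv_change[OF assms(1), of c] assms(2,3)
  by (simp add: tvec_of_def charts_at_def)

lemma unit_line:
  obtains p where "chart_deriv unit_chart p v 0 UNIV" "p 0 = \<one>"
  using chart_deriv_line[OF unit_chart, of v UNIV] unit_chart by auto

lemma tvec_of_unit_chart [simp]: "tvec_of v unit_chart = v"
  by (rule unit_line[of v]) (metis chart_deriv_tvec_of unit_chart_at chart_deriv_unique at_neq_bot)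

text \<open>The transformation rule between two charts holds because all entries are derivatives of
  one and the same curve through the unit.\<close>

lemma tvec_of_in_lie_algebra: "tvec_of v \<in> lie_algebra"
proof -
  obtain p where p: "chart_deriv unit_chart p v 0 UNIV" "p 0 = \<one>" by (rule unit_line)
  have "tvec_of v d = dir_deriv (snd d \<circ> chart_inv c) (snd c \<one>) (tvec_of v c)"
    if "c \<in> charts_at A \<one>" "d \<in> charts_at A \<one>" for c d
  proof (rule chart_deriv_unique)
    show "chart_deriv d p (tvec_of v d) 0 UNIV"
      using p that by (intro chart_deriv_tvec_of)
    show "chart_deriv d p (dir_deriv (snd d \<circ> chart_inv c) (snd c \<one>) (tvec_of v c)) 0 UNIV"
      using chart_deriv_change[OF chart_deriv_tvec_of[OF p that(1)], of d] p(2) that(2)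
      by (simp add: charts_at_def)
  qed simp
  moreover have "tvec_of v c = 0" if "c \<notin> charts_at A \<one>" for c
    using that by (simp add: tvec_of_def)
  ultimately show ?thesis unfolding lie_algebra_def tangent_space_def by blast
qed

lemma tvec_of_coordinate:
  assumes "X \<in> lie_algebra" shows "tvec_of (X unit_chart) = X"
proof
  fix c
  from assms have "c \<notin> charts_at A \<one> \<Longrightarrow> X c = 0"
    "c \<in> charts_at A \<one> \<Longrightarrow> X c = dir_deriv (snd c \<circ> chart_inv unit_chart) (snd unit_chart \<one>) (X unit_chart)"
    using unit_chart_at unfolding lie_algebra_def tangent_space_def by blast+
  then show "tvec_of (X unit_chart) c = X c" by (simp add: tvec_of_def)
qed

lemma tvec_of_add: "tvec_of (v + w) = tvec_add (tvec_of v) (tvec_of w)"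
proof
  fix c
  show "tvec_of (v + w) c = tvec_add (tvec_of v) (tvec_of w) c"
    using dir_deriv_add[OF chart_change_C1[OF unit_chart(1), of c], of "snd unit_chart \<one>" v w] unit_chart
    by (auto simp: tvec_of_def tvec_add_def charts_at_def)
qed

lemma tvec_of_scale: "tvec_of (r *\<^sub>R v) = tvec_scale r (tvec_of v)"
proof
  fix c
  show "tvec_of (r *\<^sub>R v) c = tvec_scale r (tvec_of v) c"
    using dir_deriv_scale[OF chart_change_C1[OF unit_chart(1), of c], of "snd unit_chart \<one>" r v] unit_chart
    by (auto simp: tvec_of_def tvec_scale_def charts_at_def)
qed

lemma tvec_of_diff: "tvec_of (v - w) = tvec_diff (tvec_of v) (tvec_of w)"
  using tvec_of_add[of "v - w" w] by (auto simp: tvec_add_def tvec_diff_def fun_eq_iff)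

lemma continuous_tvec_of: "continuous_on UNIV tvec_of"
proof (rule continuous_on_coordinatewise_then_product)
  fix c :: "('g, 'e) chart"
  show "continuous_on UNIV (\<lambda>v. tvec_of v c)"
  proof (cases "c \<in> charts_at A \<one>")
    case True
    then have "snd unit_chart \<one> \<in> snd unit_chart ` (fst unit_chart \<inter> fst c)"
      using unit_chart by (auto simp: charts_at_def)
    with True show ?thesis
      unfolding continuous_on_def tvec_of_def using chart_change_C1[OF unit_chart(1), of c]
      by (auto simp: charts_at_def intro!: tendsto_dir_deriv tendsto_ident_at)
  qed (simp add: tvec_of_def)
qed

text \<open>Links the definition through \<open>velocity\<close> and \<open>tangent_map\<close> to
  \<open>has_log_deriv\<close>: in each chart at the unit, both sides are derivatives of the
  translated curve.\<close>

lemma right_log_deriv_eq: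
  assumes \<mu>: "has_log_deriv \<mu> v t {0..1}" and t: "t \<in> {0..1}"
  shows "right_log_deriv \<mu> t = tvec_of v"
proof
  fix d
  \<comment> \<open>This is the chart that \<open>tangent_map\<close> selects at
    \<open>\<mu> t\<close>.\<close>
  define c where "c = (SOME c. c \<in> charts_at A (\<mu> t))"
  obtain c' where "c' \<in> A" "\<mu> t \<in> fst c'" by (rule chart_exists)
  then have "c' \<in> charts_at A (\<mu> t)" by (simp add: charts_at_def)
  then have "c \<in> charts_at A (\<mu> t)" unfolding c_def by (rule someI)
  then have c: "c \<in> A" "\<mu> t \<in> fst c" by (auto simp: charts_at_def)
  obtain r where r: "r \<in> A" "inv (\<mu> t) \<in> fst r" by (rule chart_exists)
  define u where "u = mult_deriv unit_chart c c \<one> (\<mu> t) v 0"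
  have u: "chart_deriv c \<mu> u t {0..1}"
    unfolding u_def using \<mu> c by (rule has_log_deriv_chart_deriv)
  then have vel: "velocity A \<mu> t c = u"
    using at_within_unit_interval[OF t] c
    by (auto simp: velocity_def chart_deriv_def curve_deriv_def charts_at_def intro!: tendsto_Lim)
  show "right_log_deriv \<mu> t d = tvec_of v d"
  proof (cases "d \<in> charts_at A \<one>")
    case True
    then have d: "d \<in> A" "\<one> \<in> fst d" by (auto simp: charts_at_def)
    have "dir_deriv (snd d \<circ> (\<lambda>h. h \<otimes> inv (\<mu> t)) \<circ> chart_inv c) (snd c (\<mu> t)) u
        = mult_deriv c r d (\<mu> t) (inv (\<mu> t)) u 0"
      using chart_deriv_mult[OF chart_deriv_line[OF c] chart_deriv_const[OF r] d(1), of u UNIV] c d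
      by (intro dir_deriv_eqI) (simp add: chart_deriv_def)
    also have "\<dots> = tvec_of v d"
    proof (rule chart_deriv_unique)
      show "chart_deriv d (\<lambda>s. \<mu> s \<otimes> inv (\<mu> t)) (mult_deriv c r d (\<mu> t) (inv (\<mu> t)) u 0) t {0..1}"
        using chart_deriv_mult[OF u chart_deriv_const[OF r] d(1)] d(2) by simp
      show "chart_deriv d (\<lambda>s. \<mu> s \<otimes> inv (\<mu> t)) (tvec_of v d) t {0..1}"
        using \<mu> True unfolding has_log_deriv_def by (intro chart_deriv_tvec_of) simp_all
    qed (rule at_within_unit_interval[OF t])
    finally show ?thesis
      using True vel by (simp add: right_log_deriv_def tangent_map_def c_def[symmetric])
  qed (simp add: right_log_deriv_def tangent_map_def tvec_of_def Let_def)
qed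

section \<open>C1 curves and continuous logarithmic derivatives\<close>

lemma C1_curve_chart_deriv:
  assumes \<nu>: "C1_curve_on A J \<nu>" and J: "open J" "t \<in> J" and c: "c \<in> A" "\<nu> t \<in> fst c"
  shows "chart_deriv c \<nu> (dir_deriv (snd c \<circ> \<nu>) t 1) t UNIV"
proof -
  have "bastiani_C 1 (snd c \<circ> \<nu>) {t \<in> J. \<nu> t \<in> fst c}"
    using \<nu> c by (simp add: C1_curve_on_def)
  from curve_deriv_segment[OF this, of 0 t 1 UNIV]
  have "curve_deriv (\<lambda>s. snd c (\<nu> s)) (dir_deriv (snd c \<circ> \<nu>) t 1) t UNIV"
    using J c by simp
  moreover have "isCont \<nu> t"
    using \<nu> J by (simp add: C1_curve_on_def continuous_on_eq_continuous_at)
  ultimately show ?thesis using c by (simp add: chart_deriv_def isCont_def)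
qed

lemma C1_unit_curve_log_deriv:
  assumes "C1_unit_curve A \<mu>"
  obtains \<phi> where "continuous_on {0..1} \<phi>" "\<And>t. t \<in> {0..1} \<Longrightarrow> has_log_deriv \<mu> (\<phi> t) t {0..1}"
proof -
  obtain a b \<nu> where ab: "a < 0" "1 < b" and \<nu>: "C1_curve_on A {a<..<b} \<nu>"
    and eq: "\<And>t. t \<in> {0..1} \<Longrightarrow> \<nu> t = \<mu> t"
    using assms unfolding C1_unit_curve_def by auto
  \<comment> \<open>A local formula, continuous as long as \<open>\<nu>\<close> and its inverse stay
    in \<open>c\<close> and \<open>d\<close>. Uniqueness makes it independent of the charts, so the
    local formulas fit together to a continuous \<open>\<phi>\<close>.\<close>
  define D where "D c d t = mult_deriv c d unit_chart (\<nu> t) (inv (\<nu> t)) (dir_deriv (snd c \<circ> \<nu>) t 1) 0" for c d t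
  have D: "has_log_deriv \<nu> (D c d t) t UNIV"
    if "t \<in> {a<..<b}" "c \<in> A" "\<nu> t \<in> fst c" "d \<in> A" "inv (\<nu> t) \<in> fst d" for c d t
    unfolding D_def using that by (intro chart_deriv_has_log_deriv C1_curve_chart_deriv[OF \<nu>]) auto
  define \<phi> where "\<phi> t = (SOME v. has_log_deriv \<nu> v t UNIV)" for t
  have \<phi>: "\<phi> t = D c d t" "has_log_deriv \<nu> (\<phi> t) t UNIV"
    if "t \<in> {a<..<b}" "c \<in> A" "\<nu> t \<in> fst c" "d \<in> A" "inv (\<nu> t) \<in> fst d" for c d t
  proof -
    show "has_log_deriv \<nu> (\<phi> t) t UNIV"
      unfolding \<phi>_def using D[OF that] by (rule someI)
    then show "\<phi> t = D c d t"
      using D[OF that] by (rule has_log_deriv_unique) simp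
  qed
  show thesis
  proof
    show "continuous_on {0..1} \<phi>"
    proof (intro continuous_at_imp_continuous_on ballI)
      fix t :: real assume "t \<in> {0..1}"
      then have t: "t \<in> {a<..<b}" using ab by auto
      obtain c d where cd: "c \<in> A" "\<nu> t \<in> fst c" "d \<in> A" "inv (\<nu> t) \<in> fst d"
        using chart_exists by metis
      have cont: "(\<nu> \<longlongrightarrow> \<nu> t) (at t)"
        using \<nu> t by (simp add: C1_curve_on_def continuous_on_eq_continuous_at isCont_def)
      note icont = tendsto_inv_group[OF cont]
      have C1: "bastiani_C 1 (snd c \<circ> \<nu>) {t \<in> {a<..<b}. \<nu> t \<in> fst c}"
        using \<nu> cd by (simp add: C1_curve_on_def)
      have "((\<lambda>s. D c d s) \<longlongrightarrow> D c d t) (at t)"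
        unfolding D_def using cd unit_chart t
        by (intro tendsto_mult_deriv cont icont tendsto_const tendsto_dir_deriv[OF C1] tendsto_ident_at) auto
      moreover have "eventually (\<lambda>s. D c d s = \<phi> s) (at t)"
        using topological_tendstoD[OF cont chart_open(1)[OF cd(1)] cd(2)]
          topological_tendstoD[OF icont chart_open(1)[OF cd(3)] cd(4)]
          topological_tendstoD[OF tendsto_ident_at open_greaterThanLessThan t]
        by eventually_elim (use cd \<phi>(1) in auto)
      ultimately have "(\<phi> \<longlongrightarrow> D c d t) (at t)" by (rule Lim_transform_eventually)
      then show "isCont \<phi> t"
        using \<phi>(1)[OF t cd] by (simp add: isCont_def)
    qed
  next
    fix t :: real assume t01: "t \<in> {0..1}"
    then have t: "t \<in> {a<..<b}" using ab by auto
    obtain c d where cd: "c \<in> A" "\<nu> t \<in> fst c" "d \<in> A" "inv (\<nu> t) \<in> fst d"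
      using chart_exists by metis
    have "has_log_deriv \<nu> (\<phi> t) t {0..1}"
      using \<phi>(2)[OF t cd] by (rule has_log_deriv_mono) simp
    then show "has_log_deriv \<mu> (\<phi> t) t {0..1}"
      by (rule has_log_deriv_cong) (use eq t01 in \<open>auto simp: eventually_at intro!: exI[of _ 1]\<close>)
  qed
qed

text \<open>The coordinate derivative depends continuously on \<open>\<nu>\<close> and
  \<open>\<phi>\<close> through \<open>mult_deriv\<close>. Curves are taken on the whole line
  because a C1 curve on the unit interval must extend to an open interval; here (-1,2).\<close>

lemma C1_unit_curveI:
  assumes \<phi>: "continuous_on UNIV \<phi>" and \<nu>: "\<And>t. has_log_deriv \<nu> (\<phi> t) t UNIV"
  shows "C1_unit_curve A \<nu>"
proof -
  have lim: "(\<nu> \<longlongrightarrow> \<nu> t) (at t)" for t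
    using has_log_deriv_continuous[OF \<nu>] .
  then have cont: "continuous_on S \<nu>" for S
    by (intro continuous_at_imp_continuous_on) (simp add: isCont_def)
  have "bastiani_C 1 (snd c \<circ> \<nu>) {t \<in> {-1<..<2}. \<nu> t \<in> fst c}" if c: "c \<in> A" for c
  proof -
    define U where "U = {t \<in> {-1<..<2}. \<nu> t \<in> fst c}"
    define f where "f = snd c \<circ> \<nu>"
    define D where "D t = mult_deriv unit_chart c c \<one> (\<nu> t) (\<phi> t) 0" for t
    have "U = {-1<..<2} \<inter> \<nu> -` fst c" by (auto simp: U_def)
    then have "open U"
      using cont chart_open(1)[OF c] by (simp add: open_Int open_vimage)
    have f: "curve_deriv f (D t) t UNIV" if "t \<in> U" for t
      using has_log_deriv_chart_deriv[OF \<nu> c] that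
      by (simp add: U_def D_def f_def chart_deriv_def comp_def)
    have seg: "curve_deriv (\<lambda>s. f (t + s *\<^sub>R v)) (v *\<^sub>R D t) 0 UNIV" if "t \<in> U" for t v
      by (rule curve_deriv_reparam[where f = "\<lambda>s. t + s *\<^sub>R v" and T = UNIV])
        (use f that in \<open>auto intro!: derivative_eq_intros\<close>)
    have dq: "(dir_quotient f t v \<longlongrightarrow> v *\<^sub>R D t) (at 0)" if "t \<in> U" for t v
    proof -
      have "(\<lambda>s. (1 / (s - 0)) *\<^sub>R (f (t + s *\<^sub>R v) - f (t + 0 *\<^sub>R v))) = dir_quotient f t v"
        by (auto simp: dir_quotient_def)
      with seg[OF that, of v] show ?thesis by (simp add: curve_deriv_def)
    qed
    have D: "continuous_on U D"
      unfolding continuous_on_def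
    proof
      fix t assume t: "t \<in> U"
      have "(\<phi> \<longlongrightarrow> \<phi> t) (at t)"
        using \<phi> by (simp add: continuous_on_eq_continuous_at isCont_def)
      then have "(D \<longlongrightarrow> D t) (at t)"
        unfolding D_def using t c unit_chart
        by (intro tendsto_mult_deriv lim tendsto_const) (auto simp: U_def)
      then show "(D \<longlongrightarrow> D t) (at t within U)"
        by (rule tendsto_within_subset) simp
    qed
    have "continuous_on U f"
      unfolding continuous_on_def
      by (blast intro: tendsto_within_subset[OF curve_deriv_continuous[OF f]])
    then have 0: "continuous_on (U \<times> UNIV) (\<lambda>(x, w::nat \<Rightarrow> real). f x)"
      unfolding split_def by (rule continuous_on_compose2) (auto intro!: continuous_intros)
    have w: "continuous_on (U \<times> UNIV) (\<lambda>p. snd p (0::nat) :: real)"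
      using continuous_on_product_then_coordinatewise[OF continuous_on_snd[OF continuous_on_id]] .
    have DU: "continuous_on (U \<times> (UNIV :: (nat \<Rightarrow> real) set)) (\<lambda>p. D (fst p))"
      by (rule continuous_on_compose2[OF D]) (auto intro!: continuous_intros)
    have "continuous_on (U \<times> UNIV) (\<lambda>p. (snd p (0::nat) :: real) *\<^sub>R D (fst p))"
      using w DU by (simp add: continuous_on_def tendsto_scaleR_lcs)
    then have "continuous_on (U \<times> UNIV) (\<lambda>(x, w::nat \<Rightarrow> real). dir_deriv f x (w 0))"
      by (rule continuous_on_eq) (use dir_deriv_eqI[OF seg] in auto)
    then have 1: "continuous_on (U \<times> UNIV) (\<lambda>(x, w). iter_deriv f (map w [0..<1]) x)"
      by simp
    have "continuous_on (U \<times> UNIV) (\<lambda>(x, w). iter_deriv f (map w [0..<p]) x)" if "p \<le> 1" for p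
      using 0 1 that by (cases "p = 0") (auto simp: le_Suc_eq)
    with \<open>open U\<close> dq have "bastiani_C 1 f U"
      unfolding bastiani_C_def by auto
    then show ?thesis by (simp add: U_def f_def)
  qed
  with cont have "C1_curve_on A {-1<..<2} \<nu>"
    by (simp add: C1_curve_on_def)
  then show ?thesis
    unfolding C1_unit_curve_def by (intro exI[of _ "-1"] exI[of _ 2] exI[of _ \<nu>]) simp
qed

section \<open>Evolutions\<close>

lemma is_log_derivI:
  assumes "continuous_on UNIV \<phi>" "\<And>t. has_log_deriv \<nu> (\<phi> t) t UNIV"
  shows "is_log_deriv \<nu> (\<lambda>t. tvec_of (\<phi> t))"
proof -
  have "right_log_deriv \<nu> t = tvec_of (\<phi> t)" if "t \<in> {0..1}" for t
    using assms(2) that by (intro right_log_deriv_eq) (auto intro: has_log_deriv_mono)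
  then show ?thesis
    using C1_unit_curveI[OF assms] by (simp add: is_log_deriv_def)
qed

text \<open>The quotient \<open>inv (\<mu> s) \<otimes> \<nu> s\<close> has zero logarithmic
  derivative and is therefore constant. This makes the description in \<open>Evol\<close>
  definite.\<close>

lemma is_log_deriv_unique:
  assumes \<mu>: "is_log_deriv \<mu> \<Phi>" and \<nu>: "is_log_deriv \<nu> \<Phi>" and t: "t \<in> {0..1}"
  shows "\<mu> t \<otimes> inv (\<mu> 0) = \<nu> t \<otimes> inv (\<nu> 0)"
proof -
  obtain \<phi> where \<phi>: "\<And>t. t \<in> {0..1} \<Longrightarrow> has_log_deriv \<mu> (\<phi> t) t {0..1}"
    using \<mu> C1_unit_curve_log_deriv unfolding is_log_deriv_def by metis
  obtain \<psi> where \<psi>: "\<And>t. t \<in> {0..1} \<Longrightarrow> has_log_deriv \<nu> (\<psi> t) t {0..1}"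
    using \<nu> C1_unit_curve_log_deriv unfolding is_log_deriv_def by metis
  have "tvec_of (\<phi> s) = tvec_of (\<psi> s)" if "s \<in> {0..1}" for s
    using right_log_deriv_eq[OF \<phi>[OF that] that] right_log_deriv_eq[OF \<psi>[OF that] that] \<mu> \<nu> that
    by (simp add: is_log_deriv_def)
  then have eq: "\<psi> s - \<phi> s = 0" if "s \<in> {0..1}" for s
    using that tvec_of_unit_chart by (metis right_minus_eq)
  have Ad0: "Ad g 0 = 0" for g by (simp add: Ad_def)
  have "has_log_deriv (\<lambda>s. inv (\<mu> s) \<otimes> \<nu> s) 0 s {0..t}" if "s \<in> {0..t}" for s
  proof -
    have "s \<in> {0..1}" using that t by auto
    from has_log_deriv_quotient[OF \<phi>[OF this] \<psi>[OF this]] eq[OF this]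
    show ?thesis using t by (auto simp: Ad0 intro: has_log_deriv_mono)
  qed
  with t have "inv (\<mu> t) \<otimes> \<nu> t = inv (\<mu> 0) \<otimes> \<nu> 0"
    by (intro zero_log_deriv_constant) auto
  then have "\<mu> t \<otimes> (inv (\<mu> t) \<otimes> \<nu> t) \<otimes> inv (\<nu> 0) = \<mu> t \<otimes> (inv (\<mu> 0) \<otimes> \<nu> 0) \<otimes> inv (\<nu> 0)"
    by (rule arg_cong)
  moreover have "\<mu> t \<otimes> (inv (\<mu> t) \<otimes> \<nu> t) = \<nu> t"
    by (simp add: m_assoc[symmetric])
  moreover have "\<mu> t \<otimes> (inv (\<mu> 0) \<otimes> \<nu> 0) \<otimes> inv (\<nu> 0) = \<mu> t \<otimes> inv (\<mu> 0)"
    by (simp add: m_assoc)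
  ultimately show ?thesis by simp
qed

lemma Evol_eq:
  assumes "is_log_deriv \<nu> \<phi>" "t \<in> {0..1}"
  shows "Evol \<phi> t = \<nu> t \<otimes> inv (\<nu> 0)"
  unfolding Evol_def using assms is_log_deriv_unique by blast

lemma is_log_deriv_evol_domain: "is_log_deriv \<nu> \<phi> \<Longrightarrow> \<phi> \<in> evol_domain"
  by (auto simp: evol_domain_def)

end

section \<open>Seminorms dominating the adjoint action along a compact arc\<close>

definition lcs_seminorm :: "('e::locally_convex_space \<Rightarrow> real) \<Rightarrow> bool" where
  "lcs_seminorm p \<longleftrightarrow> continuous_on UNIV p \<and> (\<forall>v w. p (v + w) \<le> p v + p w) \<and>
     (\<forall>r v. p (r *\<^sub>R v) = \<bar>r\<bar> * p v)"

lemma lcs_seminorm_add: "lcs_seminorm p \<Longrightarrow> p (v + w) \<le> p v + p w"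
  and lcs_seminorm_scale: "lcs_seminorm p \<Longrightarrow> p (r *\<^sub>R v) = \<bar>r\<bar> * p v"
  and lcs_seminorm_continuous: "lcs_seminorm p \<Longrightarrow> continuous_on UNIV p"
  by (simp_all add: lcs_seminorm_def)

lemma lcs_seminorm_zero: "lcs_seminorm p \<Longrightarrow> p 0 = 0"
  using lcs_seminorm_scale[of p 0 0] by simp

lemma lcs_seminorm_minus: "lcs_seminorm p \<Longrightarrow> p (- v) = p v"
  using lcs_seminorm_scale[of p "-1" v] by simp

lemma lcs_seminorm_nonneg: "lcs_seminorm p \<Longrightarrow> 0 \<le> p v"
  using lcs_seminorm_add[of p v "- v"] by (simp add: lcs_seminorm_zero lcs_seminorm_minus)

text \<open>By the reverse triangle inequality, continuity at 0 spreads to every point.\<close>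

lemma lcs_seminormI:
  fixes p :: "'e::locally_convex_space \<Rightarrow> real"
  assumes add: "\<And>v w. p (v + w) \<le> p v + p w" and scale: "\<And>r v. p (r *\<^sub>R v) = \<bar>r\<bar> * p v"
    and lim: "(p \<longlongrightarrow> 0) (nhds 0)"
  shows "lcs_seminorm p"
proof -
  have minus: "p (- v) = p v" for v using scale[of "-1" v] by simp
  have diff: "\<bar>p w - p v\<bar> \<le> p (w - v)" for v w
    using add[of "w - v" v] add[of "v - w" w] minus[of "w - v"] by simp
  have "(p \<longlongrightarrow> p v) (at v)" for v
  proof -
    have "((\<lambda>w. w - v) \<longlongrightarrow> v - v) (at v)"
      by (intro tendsto_diff tendsto_ident_at tendsto_const)
    then have "((\<lambda>w. p (w - v)) \<longlongrightarrow> 0) (at v)"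
      by (intro filterlim_compose[OF lim]) simp
    then have "((\<lambda>w. p w - p v) \<longlongrightarrow> 0) (at v)"
      by (rule Lim_null_comparison[rotated]) (use diff in auto)
    then show ?thesis by (simp add: LIM_zero_iff)
  qed
  then show ?thesis
    using add scale by (simp add: lcs_seminorm_def continuous_on_def)
qed

context lie_group
begin

lemma cont_seminorm_tvec_of:
  assumes "cont_seminorm q" shows "lcs_seminorm (\<lambda>v. q (tvec_of v))"
proof -
  have "continuous_on lie_algebra q" using assms by (simp add: cont_seminorm_def)
  then have "continuous_on UNIV (\<lambda>v. q (tvec_of v))"
    using continuous_tvec_of by (rule continuous_on_compose2) (use tvec_of_in_lie_algebra in auto)
  with assms show ?thesis
    by (simp add: lcs_seminorm_def cont_seminorm_def tvec_of_add tvec_of_scale tvec_of_in_lie_algebra)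
qed

lemma lcs_seminorm_cont_seminorm:
  assumes "lcs_seminorm p" shows "cont_seminorm (\<lambda>X. p (X unit_chart))"
proof -
  have "continuous_on lie_algebra (\<lambda>X. X unit_chart)"
    using continuous_on_product_then_coordinatewise[OF continuous_on_id] .
  from continuous_on_compose2[OF lcs_seminorm_continuous[OF assms] this]
  have "continuous_on lie_algebra (\<lambda>X. p (X unit_chart))" by simp
  with assms show ?thesis
    by (simp add: lcs_seminorm_def cont_seminorm_def tvec_add_def tvec_scale_def)
qed

text \<open>\<open>P\<close> is the supremum of the seminorms over the arc. Compactness makes it
  finite, and joint continuity of \<open>Ad\<close> with the tube lemma makes it continuous at
  0.\<close>

lemma sup_Ad_seminorm:
  fixes g :: "real \<Rightarrow> 'g"
  assumes p: "lcs_seminorm p" and g: "\<And>t. (g \<longlongrightarrow> g t) (at t)" and l: "0 \<le> l"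
  obtains P where "lcs_seminorm P" "\<And>r v. r \<in> {0..l} \<Longrightarrow> p (Ad (g r) v) \<le> P v"
proof
  define P where "P v = (SUP r\<in>{0..l}. p (Ad (g r) v))" for v
  have cont: "continuous_on UNIV (\<lambda>(v, r). p (Ad (g r) v))"
    unfolding continuous_on_def
  proof
    fix x :: "'e \<times> real"
    have "isCont g (snd x)" using g by (simp add: isCont_def)
    then have "((\<lambda>y. g (snd y)) \<longlongrightarrow> g (snd x)) (at x)"
      by (rule isCont_tendsto_compose) (intro tendsto_snd tendsto_ident_at)
    then have "((\<lambda>y. Ad (g (snd y)) (fst y)) \<longlongrightarrow> Ad (g (snd x)) (fst x)) (at x)"
      by (intro tendsto_Ad tendsto_fst tendsto_ident_at)
    moreover have "isCont p (Ad (g (snd x)) (fst x))"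
      using lcs_seminorm_continuous[OF p] by (simp add: continuous_on_eq_continuous_at)
    ultimately show "((\<lambda>(v, r). p (Ad (g r) v)) \<longlongrightarrow> (case x of (v, r) \<Rightarrow> p (Ad (g r) v))) (at x)"
      unfolding split_def by (rule isCont_tendsto_compose[rotated])
  qed
  have bdd: "bdd_above ((\<lambda>r. p (Ad (g r) v)) ` {0..l})" for v
  proof -
    have "continuous_on {0..l} (\<lambda>r. (v, r))" by (intro continuous_intros)
    from continuous_on_compose2[OF cont this] have "continuous_on {0..l} (\<lambda>r. p (Ad (g r) v))" by simp
    then show ?thesis
      by (intro bounded_imp_bdd_above compact_imp_bounded compact_continuous_image) simp_all
  qed
  show upper: "p (Ad (g r) v) \<le> P v" if "r \<in> {0..l}" for r v
    unfolding P_def using bdd that by (intro cSUP_upper)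
  have least: "P v \<le> B" if "\<And>r. r \<in> {0..l} \<Longrightarrow> p (Ad (g r) v) \<le> B" for v B
    unfolding P_def using l that by (intro cSUP_least) auto
  have nonneg: "0 \<le> P v" for v
    using upper[of 0 v] lcs_seminorm_nonneg[OF p, of "Ad (g 0) v"] l by auto
  have le: "P (r *\<^sub>R v) \<le> \<bar>r\<bar> * P v" for r v
    by (rule least) (simp add: Ad_scale lcs_seminorm_scale[OF p] upper mult_left_mono)
  show "lcs_seminorm P"
  proof (rule lcs_seminormI)
    show "P (v + w) \<le> P v + P w" for v w
    proof (rule least)
      fix r assume "r \<in> {0..l}"
      then show "p (Ad (g r) (v + w)) \<le> P v + P w"
        using lcs_seminorm_add[OF p, of "Ad (g r) v" "Ad (g r) w"] upper[of r v] upper[of r w]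
        by (simp add: Ad_add)
    qed
    show "P (r *\<^sub>R v) = \<bar>r\<bar> * P v" for r v
    proof (cases "r = 0")
      case True then show ?thesis using le[of 0 v] nonneg[of 0] by simp
    next
      case False
      \<comment> \<open>The reverse inequality is the first one applied to the factor
        \<open>1 / r\<close>.\<close>
      then have "\<bar>r\<bar> * P v \<le> P (r *\<^sub>R v)"
        using le[of "1 / r" "r *\<^sub>R v"] by (simp add: field_simps)
      with le[of r v] show ?thesis by simp
    qed
    show "(P \<longlongrightarrow> 0) (nhds 0)"
    proof (rule order_tendstoI)
      fix a :: real assume "a < 0"
      then show "eventually (\<lambda>v. a < P v) (nhds 0)"
        using nonneg by (intro always_eventually) (auto intro: less_le_trans)
    next
      fix a :: real assume a: "0 < a"
      \<comment> \<open>Half of \<open>a\<close> leaves room for the supremum, which preserves only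
        weak inequalities.\<close>
      have "open ((\<lambda>(v, r). p (Ad (g r) v)) -` {..<a/2})"
        using cont by (intro open_vimage) auto
      moreover have "{0} \<times> {0..l} \<subseteq> (\<lambda>(v, r). p (Ad (g r) v)) -` {..<a/2}"
        using a Ad_scale[of _ 0 0] by (auto simp: lcs_seminorm_zero[OF p])
      ultimately obtain X where X: "0 \<in> X" "open X" "X \<times> {0..l} \<subseteq> (\<lambda>(v, r). p (Ad (g r) v)) -` {..<a/2}"
        using Elementary_Topology.tube_lemma[of "{0..l}"] compact_Icc by metis
      have "P v < a" if "v \<in> X" for v
      proof -
        have "P v \<le> a / 2"
        proof (rule least)
          fix r assume "r \<in> {0..l}"
          with X(3) that have "(v, r) \<in> (\<lambda>(v, r). p (Ad (g r) v)) -` {..<a/2}" by blast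
          then show "p (Ad (g r) v) \<le> a / 2" by simp
        qed
        with a show ?thesis by simp
      qed
      with X(1,2) show "eventually (\<lambda>v. P v < a) (nhds 0)"
        by (auto simp: eventually_nhds)
    qed
  qed
qed

section \<open>Periodic extension and one-parameter groups\<close>

text \<open>An integer lies in two closed pieces, which together cover both of its sides; any other
  point is interior to its piece.\<close>

lemma filterlim_at_integer_pieces:
  fixes u :: real
  assumes "\<And>k::int. u \<in> {of_int k..of_int k + 1} \<Longrightarrow> filterlim f L (at u within {of_int k..of_int k + 1})"
  shows "filterlim f L (at u)"
proof (cases "u = of_int \<lfloor>u\<rfloor>")
  case True
  define k where "k = \<lfloor>u\<rfloor>"
  have u: "u = of_int k" using True by (simp add: k_def)
  have "filterlim f L (at u within {of_int (k - 1)..of_int (k - 1) + 1})"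
    "filterlim f L (at u within {of_int k..of_int k + 1})"
    by (rule assms; simp add: u)+
  then have "filterlim f L (at u within ({of_int (k - 1)..of_int (k - 1) + 1} \<union> {of_int k..of_int k + 1}))"
    by (simp add: at_within_union filterlim_sup)
  moreover have "{of_int (k - 1)..of_int (k - 1) + 1} \<union> {of_int k..of_int k + 1} = {u - 1..u + 1}"
    by (auto simp: u)
  ultimately show ?thesis by (simp add: at_within_Icc_at)
next
  case False
  then have "of_int \<lfloor>u\<rfloor> < u" "u < of_int \<lfloor>u\<rfloor> + 1"
    using of_int_floor_le[of u] by linarith+
  then show ?thesis
    using assms[of "\<lfloor>u\<rfloor>"] by (simp add: at_within_Icc_at)
qed

lemma frac_on_integer_piece:
  assumes "f 0 = f (1::real)" "s \<in> {of_int k..of_int k + 1}"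
  shows "f (frac s) = f (s - of_int k)"
\<comment> \<open>At the right end \<open>frac s\<close> is 0, not 1; there \<open>f 0 = f 1\<close>
  is used.\<close>
proof (cases "s = of_int k + 1")
  case False
  then have "\<lfloor>s\<rfloor> = k" using assms(2) by (simp add: floor_eq_iff)
  then show ?thesis by (simp add: frac_def)
qed (simp add: assms(1) frac_def)

lemma continuous_on_frac:
  fixes f :: "real \<Rightarrow> 'b::t2_space"
  assumes f: "continuous_on {0..1} f" and "f 0 = f 1"
  shows "continuous_on UNIV (\<lambda>s. f (frac s))"
  unfolding continuous_on_def
proof
  fix u :: real
  have "((\<lambda>s. f (frac s)) \<longlongrightarrow> f (frac u)) (at u)"
  proof (rule filterlim_at_integer_pieces)
    fix k :: int assume u: "u \<in> {of_int k..of_int k + 1}"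
    have "continuous_on {of_int k..of_int k + 1} (\<lambda>s. f (s - of_int k))"
      by (rule continuous_on_compose2[OF f]) (auto intro!: continuous_intros)
    then have "continuous_on {of_int k..of_int k + 1} (\<lambda>s. f (frac s))"
      by (rule continuous_on_eq) (simp add: frac_on_integer_piece[of f, OF assms(2)])
    with u show "((\<lambda>s. f (frac s)) \<longlongrightarrow> f (frac u)) (at u within {of_int k..of_int k + 1})"
      by (simp add: continuous_on_def)
  qed
  then show "((\<lambda>s. f (frac s)) \<longlongrightarrow> f (frac u)) (at u within UNIV)" .
qed

text \<open>Concatenation of right translates over all integers. If
  \<open>\<kappa> 0 = \<one>\<close>, adjacent pieces agree at their junction. Periodicity belongs
  to the logarithmic derivative; the curve itself gains a right factor \<open>\<kappa> 1\<close> in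
  each period.\<close>

definition periodic_extension :: "(real \<Rightarrow> 'g) \<Rightarrow> real \<Rightarrow> 'g" where
  "periodic_extension \<kappa> u = \<kappa> (frac u) \<otimes> \<kappa> 1 [^] \<lfloor>u\<rfloor>"

lemma periodic_extension_piece:
  assumes "\<kappa> 0 = \<one>" "s \<in> {of_int k..of_int k + 1}"
  shows "periodic_extension \<kappa> s = \<kappa> (s - of_int k) \<otimes> \<kappa> 1 [^] k"
proof (cases "s = of_int k + 1")
  case True
  then have "\<lfloor>s\<rfloor> = k + 1" "frac s = 0" by (simp_all add: frac_def)
  moreover have "\<kappa> 1 [^] (k + 1) = \<kappa> 1 \<otimes> \<kappa> 1 [^] k"
    using int_pow_mult[of "\<kappa> 1" 1 k] by (simp add: int_pow_1 add.commute)
  ultimately show ?thesis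
    using True assms(1) by (simp add: periodic_extension_def)
next
  case False
  then have "\<lfloor>s\<rfloor> = k" using assms(2) by (simp add: floor_eq_iff)
  then show ?thesis by (simp add: periodic_extension_def frac_def)
qed

text \<open>Each piece is a shifted right translate of \<open>\<kappa>\<close>; equality of
  \<open>\<phi>\<close> at 0 and 1 makes the one-sided derivatives agree at integers.\<close>

lemma periodic_extension_log_deriv:
  assumes \<kappa>0: "\<kappa> 0 = \<one>" and \<kappa>: "\<And>t. t \<in> {0..1} \<Longrightarrow> has_log_deriv \<kappa> (\<phi> t) t {0..1}" and "\<phi> 0 = \<phi> 1"
  shows "has_log_deriv (periodic_extension \<kappa>) (\<phi> (frac u)) u UNIV"
proof -
  have piece: "has_log_deriv (periodic_extension \<kappa>) (\<phi> (frac u)) u {of_int k..of_int k + 1}"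
    if u: "u \<in> {of_int k..of_int k + 1}" for k :: int
  proof -
    have "has_log_deriv \<kappa> (\<phi> (u - of_int k)) (u - of_int k) {0..1}"
      using u by (intro \<kappa>) auto
    then have "has_log_deriv (\<lambda>s. \<kappa> (s - of_int k)) (1 *\<^sub>R \<phi> (u - of_int k)) u {of_int k..of_int k + 1}"
      by (rule has_log_deriv_reparam) (auto intro!: derivative_eq_intros)
    then have "has_log_deriv (\<lambda>s. \<kappa> (s - of_int k) \<otimes> \<kappa> 1 [^] k) (\<phi> (frac u)) u {of_int k..of_int k + 1}"
      using has_log_deriv_translate frac_on_integer_piece[of \<phi>, OF assms(3) u] by simp
    then show ?thesis
      by (rule has_log_deriv_cong)
        (use u periodic_extension_piece[of \<kappa>, OF \<kappa>0] in \<open>auto simp: eventually_at intro!: exI[of _ 1]\<close>)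
  qed
  then show ?thesis
    unfolding has_log_deriv_def chart_deriv_def curve_deriv_def
    by (auto intro!: filterlim_at_integer_pieces simp: unit_chart)
qed

text \<open>Membership in \<open>dom_exp\<close> provides a curve on the unit interval only. Its
  logarithmic derivative is constant, so it extends to the line, where negative arguments and
  arguments up to \<open>l\<close> are available.\<close>

lemma dom_exp_one_parameter_group:
  assumes X: "X \<in> dom_exp"
  obtains e where "e 0 = \<one>" "\<And>u. has_log_deriv e (X unit_chart) u UNIV"
proof -
  obtain \<mu> where \<mu>: "is_log_deriv \<mu> (\<lambda>t. X)"
    using X by (auto simp: dom_exp_def evol_domain_def)
  then obtain \<phi> where \<phi>: "\<And>t. t \<in> {0..1} \<Longrightarrow> has_log_deriv \<mu> (\<phi> t) t {0..1}"
    using C1_unit_curve_log_deriv unfolding is_log_deriv_def by metis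
  have "X unit_chart = \<phi> t" if "t \<in> {0..1}" for t
    using right_log_deriv_eq[OF \<phi>[OF that] that] \<mu> that by (simp add: is_log_deriv_def)
  with \<phi> have "has_log_deriv (\<lambda>s. \<mu> s \<otimes> inv (\<mu> 0)) (X unit_chart) t {0..1}" if "t \<in> {0..1}" for t
    using that by (intro has_log_deriv_translate) metis
  then have "has_log_deriv (periodic_extension (\<lambda>s. \<mu> s \<otimes> inv (\<mu> 0))) (X unit_chart) u UNIV" for u
    by (intro periodic_extension_log_deriv[where \<phi> = "\<lambda>_. X unit_chart"]) simp_all
  moreover have "periodic_extension (\<lambda>s. \<mu> s \<otimes> inv (\<mu> 0)) 0 = \<one>"
    by (simp add: periodic_extension_def)
  ultimately show thesis by (intro that)
qed

lemma one_parameter_log_deriv: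
  assumes "\<And>u. has_log_deriv e x u UNIV"
  shows "is_log_deriv (\<lambda>t. e (r * t + c)) (\<lambda>t. tvec_of (r *\<^sub>R x))"
proof (rule is_log_derivI)
  show "has_log_deriv (\<lambda>t. e (r * t + c)) (r *\<^sub>R x) t UNIV" for t
    by (rule has_log_deriv_reparam[where T = UNIV]) (use assms in \<open>auto intro!: derivative_eq_intros\<close>)
qed (rule continuous_on_const)

lemma lie_exp_one_parameter_group:
  assumes e0: "e 0 = \<one>" and e: "\<And>u. has_log_deriv e (X unit_chart) u UNIV" and X: "X \<in> lie_algebra"
  shows "lie_exp (tvec_scale (- \<tau>) X) = inv (e \<tau>)"
proof -
  have "tvec_scale (- \<tau>) X = tvec_of (- \<tau> *\<^sub>R X unit_chart)"
    by (metis X tvec_of_coordinate tvec_of_scale)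
  then have "lie_exp (tvec_scale (- \<tau>) X) = e (- \<tau>)"
    using Evol_eq[OF one_parameter_log_deriv[OF e, of "- \<tau>" 0], of 1] e0 by (simp add: lie_exp_def)
  \<comment> \<open>The curves \<open>e (\<tau> * t)\<close> and
    \<open>e (\<tau> * t - \<tau>)\<close> have the same logarithmic derivative; they are compared
    at \<open>t = 1\<close>.\<close>
  moreover have "e \<tau> = inv (e (- \<tau>))"
    using is_log_deriv_unique[OF one_parameter_log_deriv[OF e, of \<tau> 0]
        one_parameter_log_deriv[OF e, of \<tau> "- \<tau>"], of 1] e0 by simp
  ultimately show ?thesis by simp
qed

end

section \<open>The Trotter limit\<close>

text \<open>
  A smooth monotone reparametrization of the real line that commutes with integer translations
  and whose derivative vanishes at the integers. Precomposing with it makes the logarithmic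
  derivative of a concatenation of curves continuous at the junctions.
\<close>

definition smooth_stairs :: "real \<Rightarrow> real" where
  "smooth_stairs u = u - sin (2 * pi * u) / (2 * pi)"

definition smooth_stairs' :: "real \<Rightarrow> real" where
  "smooth_stairs' u = 1 - cos (2 * pi * u)"

lemma smooth_stairs_deriv:
  "(smooth_stairs has_real_derivative smooth_stairs' u) (at u within S)"
  unfolding smooth_stairs_def smooth_stairs'_def
  by (auto intro!: derivative_eq_intros)

lemma smooth_stairs'_bounds: "0 \<le> smooth_stairs' u" "smooth_stairs' u \<le> 2"
  using cos_le_one[of "2 * pi * u"] cos_ge_minus_one[of "2 * pi * u"]
  by (simp_all add: smooth_stairs'_def)

lemma smooth_stairs_mono: "u \<le> v \<Longrightarrow> smooth_stairs u \<le> smooth_stairs v"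
  by (rule DERIV_nonneg_imp_nondecreasing) (use smooth_stairs_deriv smooth_stairs'_bounds in blast)+

lemma smooth_stairs_of_nat [simp]: "smooth_stairs (real n) = real n"
  using sin_int_2pin[of "int n"] by (simp add: smooth_stairs_def)

lemma smooth_stairs_0_1 [simp]: "smooth_stairs 0 = 0" "smooth_stairs 1 = 1"
  using smooth_stairs_of_nat[of 0] smooth_stairs_of_nat[of 1] by simp_all

lemma smooth_stairs'_0_1 [simp]: "smooth_stairs' 0 = 0" "smooth_stairs' 1 = 0"
  by (simp_all add: smooth_stairs'_def)

lemma smooth_stairs'_frac: "smooth_stairs' (frac u) = smooth_stairs' u"
proof -
  have "2 * pi * frac u = 2 * pi * u - 2 * pi * of_int \<lfloor>u\<rfloor>"
    by (simp add: frac_def algebra_simps)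
  then have "cos (2 * pi * frac u) = cos (2 * pi * u)"
    by (simp only: cos_diff sin_int_2pin cos_int_2pin)
  then show ?thesis by (simp add: smooth_stairs'_def)
qed

lemma continuous_on_smooth_stairs: "continuous_on S smooth_stairs"
  unfolding smooth_stairs_def by (intro continuous_intros) simp

lemma continuous_on_smooth_stairs': "continuous_on S smooth_stairs'"
  unfolding smooth_stairs'_def by (intro continuous_intros)

lemma continuous_on_scaleR_lcs:
  fixes g :: "'a::topological_space \<Rightarrow> 'e::locally_convex_space"
  assumes "continuous_on S f" "continuous_on S g"
  shows "continuous_on S (\<lambda>x. f x *\<^sub>R g x)"
  using assms by (simp add: continuous_on_def tendsto_scaleR_lcs)

context lie_group
begin

text \<open>The ranges of \<open>b\<close>, \<open>y\<close> and \<open>s\<close> depend on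
  \<open>l\<close> and \<open>n\<close> but not on \<tau>, which makes later estimates uniform. The
  factor 2 in \<open>2 * l\<close> is the upper bound of \<open>smooth_stairs'\<close>.\<close>

lemma Trotter_comparison:
  fixes l \<tau> :: real and n :: nat
  assumes e0: "e 0 = \<one>" and e: "\<And>u. has_log_deriv e x u UNIV"
    and \<mu>0: "\<mu> 0 = \<one>" and \<mu>: "\<And>t. t \<in> {0..1} \<Longrightarrow> has_log_deriv \<mu> (\<phi> t) t {0..1}"
    and \<phi>: "continuous_on {0..1} \<phi>" and n: "max l 1 \<le> real n" and \<tau>: "\<tau> \<in> {0..l}"
  obtains \<alpha> a where "continuous_on UNIV a" "\<And>t. has_log_deriv \<alpha> (a t) t UNIV"
    "\<alpha> 0 = \<one>" "\<alpha> 1 = inv (e \<tau>) \<otimes> \<mu> (\<tau> / real n) [^] n"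
    "\<And>t. t \<in> {0..1} \<Longrightarrow>
      \<exists>b\<in>{0..2 * l}. \<exists>y\<in>{0..l}. \<exists>s\<in>{0..min 1 (l / real n)}. a t = b *\<^sub>R Ad (inv (e y)) (\<phi> s - x)"
proof -
  let ?\<theta> = smooth_stairs and ?\<theta>' = smooth_stairs'
  define h where "h = \<tau> / real n"
  have n0: "real n > 0" using n by simp
  have h: "0 \<le> h" "h \<le> 1" "h \<le> l / real n" "h * real n = \<tau>"
    using \<tau> n n0 by (auto simp: h_def field_simps)
  have range: "h * ?\<theta> u \<in> {0..h}" if "u \<in> {0..1}" for u
    using smooth_stairs_mono[of 0 u] smooth_stairs_mono[of u 1] that h mult_left_mono[of "?\<theta> u" 1 h]
    by auto
  then have range01: "h * ?\<theta> u \<in> {0..1}" if "u \<in> {0..1}" for u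
    using that h(2) by fastforce
  define \<kappa> where "\<kappa> u = \<mu> (h * ?\<theta> u)" for u
  define \<psi> where "\<psi> u = (h * ?\<theta>' u) *\<^sub>R \<phi> (h * ?\<theta> u)" for u
  have \<kappa>: "has_log_deriv \<kappa> (\<psi> u) u {0..1}" if "u \<in> {0..1}" for u
    unfolding \<kappa>_def \<psi>_def
    by (rule has_log_deriv_reparam[where f = "\<lambda>u. h * ?\<theta> u", OF \<mu>[OF range01[OF that]]
        DERIV_cmult[OF smooth_stairs_deriv]]) (use range01 in blast)
  have \<kappa>0: "\<kappa> 0 = \<one>" and \<psi>01: "\<psi> 0 = \<psi> 1"
    by (simp_all add: \<kappa>_def \<psi>_def \<mu>0)
  define M where "M = periodic_extension \<kappa>"
  have M: "has_log_deriv M (\<psi> (frac u)) u UNIV" for u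
    unfolding M_def using \<kappa>0 \<kappa> \<psi>01 by (rule periodic_extension_log_deriv)
  \<comment> \<open>\<open>e\<close> runs on the same clock as \<open>M\<close>, so both logarithmic
    derivatives carry the factor \<open>\<tau> * ?\<theta>' (real n * t)\<close>.\<close>
  define E where "E t = e (h * ?\<theta> (real n * t))" for t
  define \<alpha> where "\<alpha> t = inv (E t) \<otimes> M (real n * t)" for t
  define a where "a t = Ad (inv (E t)) (real n *\<^sub>R \<psi> (frac (real n * t)) - (h * (?\<theta>' (real n * t) * real n)) *\<^sub>R x)" for t
  have E: "has_log_deriv E ((h * (?\<theta>' (real n * t) * real n)) *\<^sub>R x) t UNIV" for t
  proof -
    have "((\<lambda>t. real n * t) has_real_derivative real n) (at t)"
      by (auto intro!: derivative_eq_intros)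
    from DERIV_cmult[OF DERIV_chain2[OF smooth_stairs_deriv this], of h] show ?thesis
      unfolding E_def
      by (rule has_log_deriv_reparam[where \<mu> = e and f = "\<lambda>t. h * ?\<theta> (real n * t)" and T = UNIV, OF e])
        simp
  qed
  have M': "has_log_deriv (\<lambda>t. M (real n * t)) (real n *\<^sub>R \<psi> (frac (real n * t))) t UNIV" for t
    by (rule has_log_deriv_reparam[where \<mu> = M and f = "\<lambda>t. real n * t" and T = UNIV, OF M])
      (auto intro!: derivative_eq_intros)
  have \<alpha>: "has_log_deriv \<alpha> (a t) t UNIV" for t
    unfolding \<alpha>_def a_def by (rule has_log_deriv_quotient[OF E M'])
  have "continuous_on {0..1} (\<lambda>u. \<phi> (h * ?\<theta> u))"
    by (rule continuous_on_compose2[OF \<phi>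
          continuous_on_mult[OF continuous_on_const continuous_on_smooth_stairs]])
      (use range01 in blast)
  then have "continuous_on {0..1} \<psi>"
    unfolding \<psi>_def by (intro continuous_on_scaleR_lcs continuous_on_mult continuous_on_const
        continuous_on_smooth_stairs')
  from continuous_on_frac[OF this \<psi>01] have "continuous_on UNIV (\<lambda>t. \<psi> (frac (real n * t)))"
    by (rule continuous_on_compose2) (auto intro!: continuous_intros)
  then have "continuous_on UNIV
      (\<lambda>t. real n *\<^sub>R \<psi> (frac (real n * t)) - (h * (?\<theta>' (real n * t) * real n)) *\<^sub>R x)"
    by (intro continuous_on_diff continuous_on_scaleR_lcs continuous_on_mult continuous_on_const
        continuous_on_compose2[OF continuous_on_smooth_stairs'[of UNIV]] continuous_on_id) auto
  moreover have "(E \<longlongrightarrow> E t) (at t)" for t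
    using has_log_deriv_continuous[OF E] .
  ultimately have a: "continuous_on UNIV a"
    unfolding a_def continuous_on_def by (auto intro!: tendsto_Ad tendsto_inv_group)
  have "\<exists>b\<in>{0..2 * l}. \<exists>y\<in>{0..l}. \<exists>s\<in>{0..min 1 (l / real n)}. a t = b *\<^sub>R Ad (inv (e y)) (\<phi> s - x)"
    if t: "t \<in> {0..1}" for t
  proof (intro bexI)
    define u where "u = real n * t"
    have u: "0 \<le> u" "u \<le> real n" using t n0 by (auto simp: u_def mult_left_le)
    show "a t = (\<tau> * ?\<theta>' u) *\<^sub>R Ad (inv (e (h * ?\<theta> u))) (\<phi> (h * ?\<theta> (frac u)) - x)"
    proof -
      have "real n *\<^sub>R \<psi> (frac u) - (h * (?\<theta>' u * real n)) *\<^sub>R x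
          = (\<tau> * ?\<theta>' u) *\<^sub>R (\<phi> (h * ?\<theta> (frac u)) - x)"
        by (simp add: \<psi>_def smooth_stairs'_frac h(4)[symmetric] scaleR_right_diff_distrib mult_ac)
      then show ?thesis by (simp add: a_def E_def u_def Ad_scale)
    qed
    show "h * ?\<theta> (frac u) \<in> {0..min 1 (l / real n)}"
      using range[of "frac u"] h frac_ge_0[of u] frac_lt_1[of u] by auto
    show "h * ?\<theta> u \<in> {0..l}"
      using smooth_stairs_mono[OF u(1)] smooth_stairs_mono[OF u(2)] h \<tau> mult_left_mono[of "?\<theta> u" "real n" h]
      by auto
    show "\<tau> * ?\<theta>' u \<in> {0..2 * l}"
      using smooth_stairs'_bounds[of u] \<tau> mult_mono[of \<tau> l "?\<theta>' u" 2] by auto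
  qed
  moreover have "\<alpha> 0 = \<one>"
    by (simp add: \<alpha>_def E_def e0 M_def periodic_extension_def \<kappa>0)
  moreover have "\<alpha> 1 = inv (e \<tau>) \<otimes> \<mu> (\<tau> / real n) [^] n"
  proof -
    \<comment> \<open>At an integer the fractional part is 0, which leaves
      \<open>\<kappa> 0 \<otimes> \<kappa> 1 [^] n\<close>.\<close>
    have "M (real n) = \<mu> (\<tau> / real n) [^] n"
      using \<kappa>0 int_pow_int[of G "\<kappa> 1" n]
      by (simp add: M_def periodic_extension_def frac_def) (simp add: \<kappa>_def h_def)
    then show ?thesis using h(4) by (simp add: \<alpha>_def E_def)
  qed
  ultimately show thesis using a \<alpha> by (intro that)
qed

section \<open>Reduction to evolution near the zero curve\<close>

lemma zero_is_log_deriv: "is_log_deriv (\<lambda>_. \<one>) (\<lambda>_. tvec_of 0)"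
  by (intro is_log_derivI has_log_deriv_const continuous_on_const)

text \<open>\<open>P\<close> is chosen before \<open>\<Phi>\<close>, \<open>S\<close> and
  \<open>B\<close>, so one seminorm serves all \<open>n\<close> and every choice of \<tau>.\<close>

lemma sup_seminorm_bound:
  fixes e :: "real \<Rightarrow> 'g" and \<phi> :: "'b \<Rightarrow> 'e"
  assumes q: "cont_seminorm q" and e: "\<And>t. (e \<longlongrightarrow> e t) (at t)" and l: "0 < l"
  obtains P where "lcs_seminorm P"
    "\<And>\<Phi> S B. (\<And>t. t \<in> {0..1} \<Longrightarrow>
        \<exists>b\<in>{0..2 * l}. \<exists>y\<in>{0..l}. \<exists>s\<in>S. \<Phi> t = tvec_of (b *\<^sub>R Ad (inv (e y)) (\<phi> s - x))) \<Longrightarrow>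
      (\<And>s. s \<in> S \<Longrightarrow> P (\<phi> s - x) \<le> B) \<Longrightarrow>
      sup_seminorm q (curve_diff (\<lambda>_. tvec_of 0) \<Phi>) \<in> {0..2 * l * B}"
proof -
  note p = cont_seminorm_tvec_of[OF q]
  obtain P where P: "lcs_seminorm P" "\<And>r v. r \<in> {0..l} \<Longrightarrow> q (tvec_of (Ad (inv (e r)) v)) \<le> P v"
    using sup_Ad_seminorm[OF p, of "\<lambda>r. inv (e r)" l] e l tendsto_inv_group by (metis less_imp_le)
  show thesis
  proof (rule that[OF P(1)])
    fix \<Phi> :: "real \<Rightarrow> ('g, 'e) tvec" and S :: "'b set" and B :: real
    assume \<Phi>: "\<And>t. t \<in> {0..1} \<Longrightarrow>
        \<exists>b\<in>{0..2 * l}. \<exists>y\<in>{0..l}. \<exists>s\<in>S. \<Phi> t = tvec_of (b *\<^sub>R Ad (inv (e y)) (\<phi> s - x))"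
      and B: "\<And>s. s \<in> S \<Longrightarrow> P (\<phi> s - x) \<le> B"
    have bounds: "q (curve_diff (\<lambda>_. tvec_of 0) \<Phi> t) \<in> {0..2 * l * B}" if t: "t \<in> {0..1}" for t
    proof -
      obtain b y s where *: "b \<in> {0..2 * l}" "y \<in> {0..l}" "s \<in> S"
        "\<Phi> t = tvec_of (b *\<^sub>R Ad (inv (e y)) (\<phi> s - x))"
        using \<Phi>[OF t] by blast
      define v where "v = Ad (inv (e y)) (\<phi> s - x)"
      have "curve_diff (\<lambda>_. tvec_of 0) \<Phi> t = tvec_of (- (b *\<^sub>R v))"
        using *(4) by (simp add: curve_diff_def v_def tvec_of_diff[symmetric])
      then have "q (curve_diff (\<lambda>_. tvec_of 0) \<Phi> t) = b * q (tvec_of v)"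
        using lcs_seminorm_minus[OF p] lcs_seminorm_scale[OF p, of b v] *(1) by simp
      moreover have "0 \<le> q (tvec_of v)" using lcs_seminorm_nonneg[OF p] .
      moreover have "q (tvec_of v) \<le> B"
        using P(2)[OF *(2), of "\<phi> s - x"] B[OF *(3)] by (simp add: v_def)
      ultimately show ?thesis
        using *(1) mult_mono[of b "2 * l" "q (tvec_of v)" B] by simp
    qed
    \<comment> \<open>A bounded supremum is at least the value at \<open>t = 0\<close>; this gives
      the lower bound 0.\<close>
    have "0 \<le> q (curve_diff (\<lambda>_. tvec_of 0) \<Phi> 0)" using bounds[of 0] by simp
    also have "\<dots> \<le> sup_seminorm q (curve_diff (\<lambda>_. tvec_of 0) \<Phi>)"
      unfolding sup_seminorm_def
      by (rule cSUP_upper) (use bounds in \<open>auto intro!: bdd_aboveI2[of _ _ "2 * l * B"]\<close>)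
    finally have "0 \<le> sup_seminorm q (curve_diff (\<lambda>_. tvec_of 0) \<Phi>)" .
    moreover have "sup_seminorm q (curve_diff (\<lambda>_. tvec_of 0) \<Phi>) \<le> 2 * l * B"
      unfolding sup_seminorm_def by (rule cSUP_least) (use bounds in auto)
    ultimately show "sup_seminorm q (curve_diff (\<lambda>_. tvec_of 0) \<Phi>) \<in> {0..2 * l * B}" by simp
  qed
qed

text \<open>
  \<open>\<Phi> n\<close> is small as soon as \<open>\<phi>\<close> varies little on the initial interval of length \<open>l / n\<close>. The
  seminorm \<open>P\<close> absorbs the adjoint action, so it is independent of \<open>n\<close>.
\<close>

definition dominated :: "(real \<Rightarrow> 'e) \<Rightarrow> real \<Rightarrow> (nat \<Rightarrow> real \<Rightarrow> ('g, 'e) tvec) \<Rightarrow> bool" where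
  "dominated \<phi> l \<Phi> \<longleftrightarrow> (\<forall>q. cont_seminorm q \<longrightarrow> (\<exists>P. lcs_seminorm P \<and>
     (\<forall>n B. (\<forall>s\<in>{0..min 1 (l / real n)}. P (\<phi> s - \<phi> 0) \<le> B) \<longrightarrow>
        sup_seminorm q (curve_diff (\<lambda>_. tvec_of 0) (\<Phi> n)) \<in> {0..2 * l * B})))"

text \<open>The common core of both claims, which differ only in how domination is turned into the
  convergence that their hypothesis demands.\<close>

lemma Trotter_reduction:
  assumes \<mu>: "C1_unit_curve A \<mu>" "\<mu> 0 = \<one>" and X: "velocity A \<mu> 0 \<in> dom_exp" and l: "0 < l"
  obtains \<phi> where "continuous_on {0..1} \<phi>"
    "\<And>t. t \<in> {0..1} \<Longrightarrow> right_log_deriv \<mu> t = tvec_of (\<phi> t)"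
    "(\<And>\<Phi>. (\<And>n. \<Phi> n \<in> evol_domain) \<Longrightarrow> dominated \<phi> l \<Phi> \<Longrightarrow>
        Evol_converges \<Phi> (\<lambda>_. tvec_of 0)) \<Longrightarrow> Trotter_limit \<mu> l"
proof -
  obtain \<phi> where \<phi>: "continuous_on {0..1} \<phi>"
    and ld: "\<And>t. t \<in> {0..1} \<Longrightarrow> has_log_deriv \<mu> (\<phi> t) t {0..1}"
    using C1_unit_curve_log_deriv[OF \<mu>(1)] by metis
  define X where "X = velocity A \<mu> 0"
  have X_exp: "X \<in> dom_exp" and X_lie: "X \<in> lie_algebra"
    using X by (auto simp: X_def dom_exp_def)
  \<comment> \<open>Since \<open>\<mu> 0 = \<one>\<close>, no translation takes place at 0: velocity
    and logarithmic derivative coincide there.\<close>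
  have "chart_deriv unit_chart \<mu> (\<phi> 0) 0 {0..1}"
    using ld[of 0] \<mu>(2) by (simp add: has_log_deriv_def)
  then have X_chart: "X unit_chart = \<phi> 0"
    using at_within_unit_interval[of 0] \<mu>(2) unit_chart_at
    by (auto simp: X_def velocity_def chart_deriv_def curve_deriv_def intro!: tendsto_Lim)
  obtain e where e0: "e 0 = \<one>" and e: "\<And>u. has_log_deriv e (X unit_chart) u UNIV"
    using dom_exp_one_parameter_group[OF X_exp] by metis
  have e_cont: "(e \<longlongrightarrow> e t) (at t)" for t
    using has_log_deriv_continuous[OF e] .
  have exp: "lie_exp (tvec_scale (- \<tau>) X) = inv (e \<tau>)" for \<tau>
    by (rule lie_exp_one_parameter_group[OF e0 e X_lie])
  \<comment> \<open>The shape of the comparison curves with \<tau> eliminated, valid whichever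
    violating \<tau> is selected.\<close>
  define admissible where "admissible n \<Psi> \<longleftrightarrow> (\<forall>t\<in>{0..1}.
      \<exists>b\<in>{0..2 * l}. \<exists>y\<in>{0..l}. \<exists>s\<in>{0..min 1 (l / real n)}. \<Psi> t = tvec_of (b *\<^sub>R Ad (inv (e y)) (\<phi> s - \<phi> 0)))"
    for n :: nat and \<Psi> :: "real \<Rightarrow> ('g, 'e) tvec"
  show thesis
  proof (rule that[OF \<phi> right_log_deriv_eq[OF ld]])
    assume conv: "\<And>\<Phi>. (\<And>n. \<Phi> n \<in> evol_domain) \<Longrightarrow> dominated \<phi> l \<Phi> \<Longrightarrow>
        Evol_converges \<Phi> (\<lambda>_. tvec_of 0)"
    show "Trotter_limit \<mu> l"
      unfolding Trotter_limit_def X_def[symmetric] exp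
    proof (intro allI impI)
      fix U :: "'g set" assume U: "open U \<and> \<one> \<in> U"
      text \<open>Uniformity in \<open>\<tau>\<close>: choose a violating \<open>\<tau>\<close> for each \<open>n\<close> that admits one.\<close>
      have "\<exists>\<Psi>. \<Psi> \<in> evol_domain \<and> admissible n \<Psi> \<and> (max l 1 \<le> real n \<longrightarrow>
          (\<forall>\<tau>\<in>{0..l}. inv (e \<tau>) \<otimes> \<mu> (\<tau> / real n) [^] n \<notin> U \<longrightarrow> Evol \<Psi> 1 \<notin> U))" for n
      proof (cases "max l 1 \<le> real n \<and> (\<exists>\<tau>\<in>{0..l}. inv (e \<tau>) \<otimes> \<mu> (\<tau> / real n) [^] n \<notin> U)")
        case True
        then obtain \<tau> where n: "max l 1 \<le> real n" and \<tau>: "\<tau> \<in> {0..l}"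
          "inv (e \<tau>) \<otimes> \<mu> (\<tau> / real n) [^] n \<notin> U" by blast
        obtain \<alpha> a where a: "continuous_on UNIV a" "\<And>t. has_log_deriv \<alpha> (a t) t UNIV"
          and \<alpha>: "\<alpha> 0 = \<one>" "\<alpha> 1 = inv (e \<tau>) \<otimes> \<mu> (\<tau> / real n) [^] n"
          and adm: "\<And>t. t \<in> {0..1} \<Longrightarrow> \<exists>b\<in>{0..2 * l}. \<exists>y\<in>{0..l}. \<exists>s\<in>{0..min 1 (l / real n)}.
            a t = b *\<^sub>R Ad (inv (e y)) (\<phi> s - X unit_chart)"
          using Trotter_comparison[OF e0 e \<mu>(2) ld \<phi> n \<tau>(1)] by metis
        have "is_log_deriv \<alpha> (\<lambda>t. tvec_of (a t))"
          using a by (rule is_log_derivI)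
        moreover from this have "Evol (\<lambda>t. tvec_of (a t)) 1 = \<alpha> 1"
          using Evol_eq[of \<alpha> _ 1] \<alpha>(1) by simp
        moreover have "admissible n (\<lambda>t. tvec_of (a t))"
          using adm unfolding admissible_def X_chart by metis
        ultimately show ?thesis
          using \<tau>(2) \<alpha>(2) by (intro exI[of _ "\<lambda>t. tvec_of (a t)"]) (auto intro: is_log_deriv_evol_domain)
      next
        case False
        \<comment> \<open>Without a violating \<tau> the zero curve is a harmless filler. It also
          serves for \<open>n = 0\<close>, where \<open>l / real n\<close> is 0.\<close>
        have "admissible n (\<lambda>_. tvec_of 0)"
          using l unfolding admissible_def
          by (intro ballI bexI[of _ "0::real"]) auto
        with False show ?thesis
          using is_log_deriv_evol_domain[OF zero_is_log_deriv] by blast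
      qed
      then obtain \<Phi> where \<Phi>: "\<And>n. \<Phi> n \<in> evol_domain" "\<And>n. admissible n (\<Phi> n)"
        "\<And>n \<tau>. max l 1 \<le> real n \<Longrightarrow> \<tau> \<in> {0..l} \<Longrightarrow>
          inv (e \<tau>) \<otimes> \<mu> (\<tau> / real n) [^] n \<notin> U \<Longrightarrow> Evol (\<Phi> n) 1 \<notin> U"
        by metis
      have "Evol_converges \<Phi> (\<lambda>_. tvec_of 0)"
      proof (rule conv[OF \<Phi>(1)], unfold dominated_def, intro allI impI)
        fix q assume "cont_seminorm q"
        then obtain P where P: "lcs_seminorm P"
          "\<And>\<Psi> S B. (\<And>t. t \<in> {0..1} \<Longrightarrow>
              \<exists>b\<in>{0..2 * l}. \<exists>y\<in>{0..l}. \<exists>s\<in>S. \<Psi> t = tvec_of (b *\<^sub>R Ad (inv (e y)) (\<phi> s - \<phi> 0))) \<Longrightarrow>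
            (\<And>s. s \<in> S \<Longrightarrow> P (\<phi> s - \<phi> 0) \<le> B) \<Longrightarrow>
            sup_seminorm q (curve_diff (\<lambda>_. tvec_of 0) \<Psi>) \<in> {0..2 * l * B}"
          using sup_seminorm_bound[where \<phi> = \<phi> and x = "\<phi> 0", OF _ e_cont l] by metis
        show "\<exists>P. lcs_seminorm P \<and>
          (\<forall>n B. (\<forall>s\<in>{0..min 1 (l / real n)}. P (\<phi> s - \<phi> 0) \<le> B) \<longrightarrow>
            sup_seminorm q (curve_diff (\<lambda>_. tvec_of 0) (\<Phi> n)) \<in> {0..2 * l * B})"
        proof (intro exI conjI allI impI)
          fix n B assume "\<forall>s\<in>{0..min 1 (l / real n)}. P (\<phi> s - \<phi> 0) \<le> B"
          then show "sup_seminorm q (curve_diff (\<lambda>_. tvec_of 0) (\<Phi> n)) \<in> {0..2 * l * B}"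
            using \<Phi>(2)[of n] unfolding admissible_def by (intro P(2)) blast+
        qed (rule P(1))
      qed
      then obtain N where N: "\<And>n. n \<ge> N \<Longrightarrow> inv (Evol (\<lambda>_. tvec_of 0) 1) \<otimes> Evol (\<Phi> n) 1 \<in> U"
        using U unfolding Evol_converges_def by fastforce
      have "Evol (\<lambda>_. tvec_of 0) 1 = \<one>"
        using Evol_eq[OF zero_is_log_deriv, of 1] by simp
      with N have N: "Evol (\<Phi> n) 1 \<in> U" if "n \<ge> N" for n
        using that by simp
      obtain N' :: nat where N': "max l 1 \<le> real N'" using real_arch_simple by blast
      show "\<exists>N. max l 1 \<le> real N \<and>
          (\<forall>n\<ge>N. \<forall>\<tau>\<in>{0..l}. inv (e \<tau>) \<otimes> \<mu> (\<tau> / real n) [^] n \<in> U)"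
      proof (intro exI conjI allI impI ballI)
        show "max l 1 \<le> real (max N N')" using N' by linarith
        fix n \<tau> assume n: "n \<ge> max N N'" and \<tau>: "\<tau> \<in> {0..l}"
        have "max l 1 \<le> real n" using N' n by linarith
        with \<Phi>(3)[OF _ \<tau>] N[of n] n show "inv (e \<tau>) \<otimes> \<mu> (\<tau> / real n) [^] n \<in> U"
          by auto
      qed
    qed
  qed
qed

section \<open>The two kinds of continuity of the evolution map\<close>

lemma sequentially_0_continuous_Trotter:
  assumes "sequentially_0_continuous" shows "strong_Trotter_property"
  unfolding strong_Trotter_property_def
proof (intro allI impI)
  fix \<mu> and l :: real
  assume \<mu>: "C1_unit_curve A \<mu> \<and> \<mu> 0 = \<one> \<and> velocity A \<mu> 0 \<in> dom_exp" and l: "0 < l"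
  then obtain \<phi> where \<phi>: "continuous_on {0..1} \<phi>"
    and red: "(\<And>\<Phi>. (\<And>n. \<Phi> n \<in> evol_domain) \<Longrightarrow> dominated \<phi> l \<Phi> \<Longrightarrow>
        Evol_converges \<Phi> (\<lambda>_. tvec_of 0)) \<Longrightarrow> Trotter_limit \<mu> l"
    using Trotter_reduction[of \<mu> l] by metis
  show "Trotter_limit \<mu> l"
  proof (rule red)
    fix \<Phi> :: "nat \<Rightarrow> real \<Rightarrow> ('g, 'e) tvec"
    assume dom: "\<And>n. \<Phi> n \<in> evol_domain"
      and bound: "dominated \<phi> l \<Phi>"
    have "(\<lambda>n. sup_seminorm q (curve_diff (\<lambda>_. tvec_of 0) (\<Phi> n))) \<longlonglongrightarrow> 0"
      if q: "cont_seminorm q" for q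
    proof (rule LIMSEQ_I)
      fix r :: real assume r: "0 < r"
      obtain P where P: "lcs_seminorm P" "\<And>n B. (\<forall>s\<in>{0..min 1 (l / real n)}. P (\<phi> s - \<phi> 0) \<le> B) \<Longrightarrow>
            sup_seminorm q (curve_diff (\<lambda>_. tvec_of 0) (\<Phi> n)) \<in> {0..2 * l * B}"
        using bound q unfolding dominated_def by meson
      \<comment> \<open>Chosen so that the dominating bound \<open>2 * l * B\<close> equals
        \<open>r / 2\<close>.\<close>
      define B where "B = r / (4 * l)"
      have B: "0 < B" "2 * l * B < r" using r l by (auto simp: B_def)
      have "continuous_on {0..1} (\<lambda>s. P (\<phi> s - \<phi> 0))"
        by (rule continuous_on_compose2[OF lcs_seminorm_continuous[OF P(1)]])
          (auto intro!: continuous_on_diff \<phi> continuous_on_const)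
      then have "((\<lambda>s. P (\<phi> s - \<phi> 0)) \<longlongrightarrow> 0) (at 0 within {0..1})"
        unfolding continuous_on_def using lcs_seminorm_zero[OF P(1)]
        by (metis atLeastAtMost_iff diff_self order_refl zero_le_one)
      from order_tendstoD(2)[OF this B(1)]
      obtain d where d: "d > 0" "\<And>s. s \<in> {0..1} \<Longrightarrow> s \<noteq> 0 \<Longrightarrow> \<bar>s\<bar> < d \<Longrightarrow> P (\<phi> s - \<phi> 0) < B"
        by (auto simp: eventually_at)
      obtain N :: nat where N: "l / d < real N" using reals_Archimedean2 by blast
      have "norm (sup_seminorm q (curve_diff (\<lambda>_. tvec_of 0) (\<Phi> n)) - 0) < r" if "n \<ge> N" for n
      proof -
        have "l < d * real N" using N d(1) by (simp add: field_simps)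
        also have "\<dots> \<le> d * real n" using that d(1) by simp
        finally have "l < d * real n" .
        moreover from this have "real n > 0" using l d(1) by (metis less_trans zero_less_mult_pos)
        ultimately have "l / real n < d" by (simp add: field_simps)
        \<comment> \<open>The limit at 0 is punctured, so \<open>s = 0\<close> is treated
          separately.\<close>
        then have "P (\<phi> s - \<phi> 0) \<le> B" if "s \<in> {0..min 1 (l / real n)}" for s
          using d(2)[of s] that B(1) lcs_seminorm_zero[OF P(1)] by (cases "s = 0") auto
        with P(2)[of n B] B(2) show ?thesis by auto
      qed
      then show "\<exists>N. \<forall>n\<ge>N. norm (sup_seminorm q (curve_diff (\<lambda>_. tvec_of 0) (\<Phi> n)) - 0) < r"
        by blast
    qed
    with assms dom is_log_deriv_evol_domain[OF zero_is_log_deriv]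
    show "Evol_converges \<Phi> (\<lambda>_. tvec_of 0)"
      unfolding sequentially_0_continuous_def by blast
  qed
qed

lemma Mackey_0_continuous_Trotter:
  assumes "Mackey_0_continuous" and \<mu>: "C1_unit_curve A \<mu>" "\<mu> 0 = \<one>" "velocity A \<mu> 0 \<in> dom_exp"
    and lip: "lipschitz_curve (right_log_deriv \<mu>)" and l: "0 < l"
  shows "Trotter_limit \<mu> l"
proof -
  obtain \<phi> where \<phi>: "\<And>t. t \<in> {0..1} \<Longrightarrow> right_log_deriv \<mu> t = tvec_of (\<phi> t)"
    and red: "(\<And>\<Phi>. (\<And>n. \<Phi> n \<in> evol_domain) \<Longrightarrow> dominated \<phi> l \<Phi> \<Longrightarrow>
        Evol_converges \<Phi> (\<lambda>_. tvec_of 0)) \<Longrightarrow> Trotter_limit \<mu> l"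
    using Trotter_reduction[OF \<mu> l] by metis
  show ?thesis
  proof (rule red)
    fix \<Phi> :: "nat \<Rightarrow> real \<Rightarrow> ('g, 'e) tvec"
    assume dom: "\<And>n. \<Phi> n \<in> evol_domain"
      and bound: "dominated \<phi> l \<Phi>"
    have "\<exists>C\<ge>0. \<forall>n\<ge>1. sup_seminorm q (curve_diff (\<lambda>_. tvec_of 0) (\<Phi> n)) \<le> C * (1 / real n)"
      if q: "cont_seminorm q" for q
    proof -
      obtain P where P: "lcs_seminorm P" "\<And>n B. (\<forall>s\<in>{0..min 1 (l / real n)}. P (\<phi> s - \<phi> 0) \<le> B) \<Longrightarrow>
            sup_seminorm q (curve_diff (\<lambda>_. tvec_of 0) (\<Phi> n)) \<in> {0..2 * l * B}"
        using bound q unfolding dominated_def by meson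
      \<comment> \<open>The Lipschitz hypothesis speaks of seminorms on tangent vectors, so
        \<open>P\<close> is transported by evaluation at \<open>unit_chart\<close>.\<close>
      obtain L where L: "\<And>s t. s \<in> {0..1} \<Longrightarrow> t \<in> {0..1} \<Longrightarrow>
          P (tvec_diff (right_log_deriv \<mu> s) (right_log_deriv \<mu> t) unit_chart) \<le> L * \<bar>s - t\<bar>"
        using lip lcs_seminorm_cont_seminorm[OF P(1)] unfolding lipschitz_curve_def by metis
      \<comment> \<open>The absolute value settles the sign of the constant, which must be
        nonnegative in \<open>Mackey_converges\<close>.\<close>
      have "P (\<phi> s - \<phi> 0) \<le> \<bar>L\<bar> * (l / real n)" if s: "s \<in> {0..min 1 (l / real n)}" for s n
      proof -
        have "P (\<phi> s - \<phi> 0) \<le> L * s"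
          using L[of s 0] \<phi>[of s] \<phi>[of 0] s by (simp add: tvec_of_diff[symmetric])
        also have "\<dots> \<le> \<bar>L\<bar> * (l / real n)"
          using s by (intro mult_mono) auto
        finally show ?thesis .
      qed
      then have "sup_seminorm q (curve_diff (\<lambda>_. tvec_of 0) (\<Phi> n)) \<le> 2 * l * (\<bar>L\<bar> * (l / real n))" for n
        using P(2)[of n "\<bar>L\<bar> * (l / real n)"] by simp
      then show ?thesis
        using l by (intro exI[of _ "2 * l * \<bar>L\<bar> * l"]) (simp add: mult_ac)
    qed
    then obtain C where C: "\<And>q. cont_seminorm q \<Longrightarrow> 0 \<le> C q"
      "\<And>q n. cont_seminorm q \<Longrightarrow> n \<ge> 1 \<Longrightarrow>
        sup_seminorm q (curve_diff (\<lambda>_. tvec_of 0) (\<Phi> n)) \<le> C q * (1 / real n)"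
      by metis
    have "Mackey_converges \<Phi> (\<lambda>_. tvec_of 0)"
      unfolding Mackey_converges_def
      \<comment> \<open>One rate \<open>1 / real n\<close> serves all seminorms; the dependence on
        \<open>q\<close> sits entirely in \<open>C q\<close>, and the bounds start at
        \<open>n = 1\<close>.\<close>
      using C lim_1_over_n by (intro exI[of _ C] exI[of _ "\<lambda>_. 1"] exI[of _ "\<lambda>n. 1 / real n"]) simp
    with assms(1) dom is_log_deriv_evol_domain[OF zero_is_log_deriv]
    show "Evol_converges \<Phi> (\<lambda>_. tvec_of 0)"
      unfolding Mackey_0_continuous_def by blast
  qed
qed

end

theorem proposition1:
  fixes G :: "'g::t2_space monoid"
    and A :: "('g, 'e::locally_convex_space) chart set"
  assumes "lie_group G A"
  shows "(lie_group.sequentially_0_continuous G A \<longrightarrow> lie_group.strong_Trotter_property G A) \<and>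
    (lie_group.Mackey_0_continuous G A \<longrightarrow>
       (\<forall>\<mu>. C1_unit_curve A \<mu> \<and> \<mu> 0 = \<one>\<^bsub>G\<^esub> \<and> velocity A \<mu> 0 \<in> lie_group.dom_exp G A \<and>
            lie_group.lipschitz_curve G A (lie_group.right_log_deriv G A \<mu>) \<longrightarrow>
            (\<forall>l>0. lie_group.Trotter_limit G A \<mu> l)))"
  using lie_group.sequentially_0_continuous_Trotter[OF assms]
    lie_group.Mackey_0_continuous_Trotter[OF assms] by blast

end
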